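(* Let $\psi\in\mathfrak M^+_\infty$, $\beta\in\mathbb R$, $1\le s\le\infty$, $\frac1s+\frac1{s'}=1$. Then for every $n\in\mathbb N$ such that $\eta(n)-n\ge a>2$ and $\mu(n)\ge b>2$, $$C_a\,\psi(n)(\eta(n)-n)^{1/s'}\le E_n(L^\psi_{\beta,1})_s\le C^*_{a,b}\,\psi(n)(\eta(n)-n)^{1/s'},$$ where $$C_a=\frac{\pi}{96(1+\pi^2)^2}\,\frac{(a-1)^2(a-2)^2}{a^3(3a-4)},\qquad C^*_{a,b}=\frac{2(1+\pi^2)}{\pi}\Big(\frac{2b}{b-2}+\frac{a}{a-1}\Big).$$
   Context: Let $\mathfrak M$ be the set of positive, continuous, convex-downward functions $\psi(t)$ of $t\ge1$ with $\lim_{t\to\infty}\psi(t)=0$. For $\psi\in\mathfrak M$ put $\eta(t)=\eta(\psi;t)=\psi^{-1}(\psi(t)/2)$, where $\psi^{-1}$ is the inverse function of $\psi$, and $\mu(t)=\mu(\psi;t)=t/(\eta(t)-t)$. Let $\mathfrak M^+_\infty$ be the set of $\psi\in\mathfrak M$ for which $\mu(\psi;t)$ increases monotonically to $\infty$ as $t\to\infty$. For $\beta\in\mathbb R$ let $\Psi_\beta$ be the summable $2\pi$-periodic function with Fourier series $\sum_{k=1}^\infty\psi(k)\cos(kt-\beta\pi/2)$. $L_p$, $1\le p<\infty$, is the space of $2\pi$-periodic functions with $\|f\|_p=(\int_0^{2\pi}|f(t)|^pdt)^{1/p}<\infty$; $L_\infty$ is the space of $2\pi$-periodic essentially bounded functions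 with $\|f\|_\infty=\operatorname{ess\,sup}_t|f(t)|$. Let $B^0_p=\{\varphi\in L_1:\ \|\varphi\|_p\le1,\ \int_0^{2\pi}\varphi=0\}$. $L^\psi_{\beta,p}$ ($1\le p\le\infty$) is the set of $2\pi$-periodic functions $f$ such that for almost every $x$, $f(x)=\frac{a_0}{2}+\frac1\pi\int_{-\pi}^{\pi}\Psi_\beta(x-t)\varphi(t)\,dt$ with $a_0\in\mathbb R$, $\varphi\in B^0_p$. $\mathcal T_{2n-1}$ denotes the space of real trigonometric polynomials of degree at most $n-1$, and $E_n(L^\psi_{\beta,p})_s=\sup_{f\in L^\psi_{\beta,p}}\inf_{t_{n-1}\in\mathcal T_{2n-1}}\|f-t_{n-1}\|_s$. *)

theory Defs
  imports "HOL-Probability.Probability"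
begin

definition classM :: "(real \<Rightarrow> real) set" where
  "classM = {\<psi>. (\<forall>t\<ge>1. \<psi> t > 0) \<and> continuous_on {1..} \<psi> \<and> convex_on {1..} \<psi>
                  \<and> (\<psi> \<longlongrightarrow> 0) at_top}"

definition eta :: "(real \<Rightarrow> real) \<Rightarrow> real \<Rightarrow> real" where
  "eta \<psi> t = the_inv_into {1..} \<psi> (\<psi> t / 2)"

definition mu :: "(real \<Rightarrow> real) \<Rightarrow> real \<Rightarrow> real" where
  "mu \<psi> t = t / (eta \<psi> t - t)"

definition classM_plus_inf :: "(real \<Rightarrow> real) set" where
  "classM_plus_inf = {\<psi>. \<psi> \<in> classM \<and> mono_on {1..} (mu \<psi>) \<and> filterlim (mu \<psi>) at_top at_top}"

definition periodic2pi :: "(real \<Rightarrow> real) \<Rightarrow> bool" where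
  "periodic2pi f \<longleftrightarrow> (\<forall>x. f (x + 2*pi) = f x)"

text \<open>Psi is (a representative of) the summable 2pi-periodic function with Fourier series
  sum_{k>=1} psi(k) cos(kt - beta pi/2), i.e. its Fourier coefficients are
  a_0 = 0, a_k = psi(k) cos(beta pi/2), b_k = psi(k) sin(beta pi/2).\<close>
definition is_Psi_beta :: "(real \<Rightarrow> real) \<Rightarrow> real \<Rightarrow> (real \<Rightarrow> real) \<Rightarrow> bool" where
  "is_Psi_beta \<psi> \<beta> \<Psi> \<longleftrightarrow> periodic2pi \<Psi> \<and> set_integrable lebesgue {0..2*pi} \<Psi>
     \<and> (LINT t:{0..2*pi}|lebesgue. \<Psi> t) = 0
     \<and> (\<forall>k::nat. k \<ge> 1 \<longrightarrow>
          (1/pi) * (LINT t:{0..2*pi}|lebesgue. \<Psi> t * cos (real k * t)) = \<psi> (real k) * cos (\<beta>*pi/2)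
        \<and> (1/pi) * (LINT t:{0..2*pi}|lebesgue. \<Psi> t * sin (real k * t)) = \<psi> (real k) * sin (\<beta>*pi/2))"

definition Lnorm :: "ereal \<Rightarrow> (real \<Rightarrow> real) \<Rightarrow> ereal" where
  "Lnorm p f =
    (if p = \<infinity> then esssup (restrict_space lebesgue {0..2*pi}) (\<lambda>x. ereal \<bar>f x\<bar>)
     else if f \<in> borel_measurable lebesgue
          \<and> set_integrable lebesgue {0..2*pi} (\<lambda>x. \<bar>f x\<bar> powr real_of_ereal p)
     then ereal ((LINT x:{0..2*pi}|lebesgue. \<bar>f x\<bar> powr real_of_ereal p) powr (1 / real_of_ereal p))
     else \<infinity>)"

definition B0 :: "ereal \<Rightarrow> (real \<Rightarrow> real) set" where
  "B0 p = {\<phi>. periodic2pi \<phi> \<and> \<phi> \<in> borel_measurable lebesgue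
              \<and> set_integrable lebesgue {0..2*pi} \<phi>
              \<and> Lnorm p \<phi> \<le> 1 \<and> (LINT t:{0..2*pi}|lebesgue. \<phi> t) = 0}"

definition Lclass :: "(real \<Rightarrow> real) \<Rightarrow> real \<Rightarrow> ereal \<Rightarrow> (real \<Rightarrow> real) set" where
  "Lclass \<psi> \<beta> p = {f. periodic2pi f \<and> (\<exists>\<Psi> a0 \<phi>. is_Psi_beta \<psi> \<beta> \<Psi> \<and> \<phi> \<in> B0 p \<and>
       (AE x in lebesgue. f x = a0 / 2 + (1/pi) * (LINT t:{-pi..pi}|lebesgue. \<Psi> (x - t) * \<phi> t)))}"

definition trig_polys :: "nat \<Rightarrow> (real \<Rightarrow> real) set" where
  "trig_polys n = {t. \<exists>a b :: nat \<Rightarrow> real.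
      t = (\<lambda>x. (\<Sum>k<n. a k * cos (real k * x) + b k * sin (real k * x)))}"

definition best_approx :: "nat \<Rightarrow> (real \<Rightarrow> real) set \<Rightarrow> ereal \<Rightarrow> ereal" where
  "best_approx n K s = (SUP f\<in>K. INF t\<in>trig_polys n. Lnorm s (\<lambda>x. f x - t x))"

definition conj_inv :: "ereal \<Rightarrow> real" where
  "conj_inv s = (if s = \<infinity> then 1 else 1 - 1 / real_of_ereal s)"

end

theory Submission
  imports Defs
begin

text \<open>Write \<open>m = \<eta>(n) - n\<close>. Monotonicity of \<open>\<mu>\<close> makes \<open>\<eta>(t) - t\<close> grow slowly, so that the tail sum of
  \<open>\<psi>\<close> from \<open>n\<close> on is of order \<open>\<psi>(n) m\<close> and the slope of \<open>\<psi>\<close> at \<open>n\<close> is of order \<open>\<psi>(n) / m\<close>.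

  Upper bound: modulo polynomials of degree below \<open>n\<close>, \<open>\<Psi>\<^sub>\<beta>\<close> is a kernel \<open>K\<close> whose coefficients
  rise linearly to \<open>\<psi>(n)\<close> and then follow \<open>\<psi>\<close>. Bounding the coefficients gives
  \<open>\<bar>K(u)\<bar> \<lesssim> \<psi>(n) m\<close>, and bounding their second differences gives \<open>u\<^sup>2 \<bar>K(u)\<bar> \<lesssim> \<psi>(n) / m\<close>. Hence
  \<open>K\<close> has sup norm of order \<open>\<psi>(n) m\<close> and \<open>L\<^sub>1\<close> norm of order \<open>\<psi>(n)\<close>; these two bounds pass to
  the convolution with \<open>\<phi>\<close> and are interpolated.

  Lower bound: let \<open>F\<close> be a Fejer kernel of degree about \<open>m / 2\<close>. Convolving \<open>\<Psi>\<^sub>\<beta>\<close> with the modulated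
  kernel \<open>F(t) cos(N t) / (2 \<pi>)\<close>, whose frequencies lie in \<open>[n, \<eta>(n)]\<close>, gives a function of the
  class, and \<open>F(t) cos(N t - \<beta> \<pi> / 2)\<close> is a test function orthogonal to the polynomials of degree
  below \<open>n\<close>.\<close>

section \<open>Decay of the coefficient function\<close>

text \<open>The value 2 in the hypotheses is where the estimates turn. Since
  \<open>eta \<psi> t - t = t / mu \<psi> t\<close> with \<open>mu\<close> nondecreasing, the
  distance over which \<psi> halves grows at most linearly, with slope
  \<open>1 / mu \<psi> n \<le> 1/b < 1/2\<close>. This is slow enough for the coefficients to be
  absolutely summable, so the kernel of the class is continuous up to a null set and every series
  below converges uniformly. The same bound gives \<open>2 * m < n\<close>, hence room for a ramp
  that has died out at the frequencies 0 and 1, and \<open>m > 2\<close> lets \<open>m + 1\<close>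
  be absorbed into \<open>3/2 * m\<close>. The class admits any integrable function with the
  prescribed Fourier coefficients. Replacing it by the cosine series therefore rests on uniqueness
  of Fourier coefficients for merely integrable functions. The constants of the theorem are reached
  by comparison at the end: the argument itself yields \<open>1 / (128 * pi)\<close> from below and,
  with \<open>D = 2 * b / (b - 2)\<close>, the factor \<open>1 + 3/2 * D + 5 * pi^2 / 4\<close> from
  above.\<close>

text \<open>The endpoints move one at a time, through the chord from \<open>x\<close> to
  \<open>v\<close>. Stating it for decreases rather than slopes keeps the signs positive when it is
  applied to \<psi>.\<close>

lemma convex_on_secant_decrease:
  fixes f :: "real \<Rightarrow> real"
  assumes "convex_on I f" "x \<in> I" "y \<in> I" "u \<in> I" "v \<in> I"
    and "x < y" "u < v" "x \<le> u" "y \<le> v"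
  shows "(f u - f v) / (v - u) \<le> (f x - f y) / (y - x)"
proof -
  have 1: "(f x - f v) / (v - x) \<le> (f x - f y) / (y - x)"
  proof (cases "y = v")
    case False
    then have "(f x - f y) / (x - y) \<le> (f x - f v) / (x - v)"
      using convex_on_slope_le(1)[of I f x v y] assms by auto
    then have "- ((f x - f v) / (x - v)) \<le> - ((f x - f y) / (x - y))" by simp
    then show ?thesis
      by (simp add: minus_divide_right)
  qed auto
  have 2: "(f u - f v) / (v - u) \<le> (f x - f v) / (v - x)"
  proof (cases "x = u")
    case False
    then have "(f x - f v) / (x - v) \<le> (f u - f v) / (u - v)"
      using convex_on_slope_le(2)[of I f x v u] assms by auto
    then have "- ((f u - f v) / (u - v)) \<le> - ((f x - f v) / (x - v))" by simp
    then show ?thesis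
      by (simp add: minus_divide_right)
  qed auto
  from 1 2 show ?thesis by linarith
qed

lemma classM_D:
  assumes "\<psi> \<in> classM"
  shows "t \<ge> 1 \<Longrightarrow> \<psi> t > 0" "continuous_on {1..} \<psi>" "convex_on {1..} \<psi>" "(\<psi> \<longlongrightarrow> 0) at_top"
  using assms by (auto simp: classM_def)

text \<open>If \<psi> failed to drop from \<open>x\<close> to \<open>y\<close>, convexity would keep
  it above the positive value \<open>\<psi> y\<close> from there on, against the limit 0.\<close>

lemma classM_strict_decreasing:
  assumes M: "\<psi> \<in> classM" and xy: "1 \<le> x" "x < y"
  shows "\<psi> y < \<psi> x"
proof (rule ccontr)
  assume "\<not> \<psi> y < \<psi> x"
  then have le: "\<psi> x - \<psi> y \<le> 0" by simp
  have "\<psi> z \<ge> \<psi> y" if "z > y" for z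
  proof -
    have "(\<psi> y - \<psi> z) / (z - y) \<le> (\<psi> x - \<psi> y) / (y - x)"
      using convex_on_secant_decrease[OF classM_D(3)[OF M], of x y y z] xy that by auto
    also have "\<dots> \<le> 0" using le xy by (simp add: divide_nonpos_pos)
    finally show ?thesis using that by (simp add: divide_le_0_iff)
  qed
  then have "eventually (\<lambda>z. \<psi> z \<ge> \<psi> y) at_top"
    by (intro eventually_at_top_dense[THEN iffD2]) blast
  with classM_D(4)[OF M] have "\<psi> y \<le> 0"
    by (intro tendsto_lowerbound[of \<psi> 0 at_top]) auto
  with classM_D(1)[OF M, of y] xy show False by simp
qed

lemma classM_antimono:
  assumes "\<psi> \<in> classM" "1 \<le> x" "x \<le> y"
  shows "\<psi> y \<le> \<psi> x"
  using classM_strict_decreasing[OF assms(1,2)] assms(3) by (cases "x = y") (auto intro: less_imp_le)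

lemma classM_inj_on: "\<psi> \<in> classM \<Longrightarrow> inj_on \<psi> {1..}"
  by (rule linorder_inj_onI') (auto dest: classM_strict_decreasing)

text \<open>The inverse in \<open>eta\<close> has a meaningful value only once a preimage of
  \<open>\<psi> t / 2\<close> exists; the intermediate value theorem supplies one. Afterwards
  \<open>eta\<close> is used only through these two facts.\<close>

lemma eta_props:
  assumes M: "\<psi> \<in> classM" and t: "1 \<le> t"
  shows psi_eta: "\<psi> (eta \<psi> t) = \<psi> t / 2" and eta_gt: "t < eta \<psi> t"
proof -
  have pos: "\<psi> t > 0" using classM_D(1)[OF M t] .
  have "eventually (\<lambda>z. \<psi> z < \<psi> t / 2) at_top"
    using order_tendstoD(2)[OF classM_D(4)[OF M], of "\<psi> t / 2"] pos by simp
  then obtain T where T: "\<And>z. z \<ge> T \<Longrightarrow> \<psi> z < \<psi> t / 2"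
    by (auto simp: eventually_at_top_linorder)
  have "\<exists>x. t \<le> x \<and> x \<le> max t T \<and> \<psi> x = \<psi> t / 2"
    using T[of "max t T"] pos t
    by (intro IVT2') (auto intro!: continuous_on_subset[OF classM_D(2)[OF M]])
  then obtain u where "t \<le> u" and u: "\<psi> u = \<psi> t / 2" by blast
  with t have "u \<ge> 1" by simp
  then have "\<psi> t / 2 \<in> \<psi> ` {1..}" using u by (metis atLeast_iff image_eqI)
  then have 1: "\<psi> (eta \<psi> t) = \<psi> t / 2" and 2: "eta \<psi> t \<in> {1..}"
    unfolding eta_def
    using f_the_inv_into_f[OF classM_inj_on[OF M]] the_inv_into_into[OF classM_inj_on[OF M]]
    by blast+
  show "\<psi> (eta \<psi> t) = \<psi> t / 2" by fact
  show "t < eta \<psi> t"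
  proof (rule ccontr)
    assume "\<not> ?thesis"
    then have "\<psi> t \<le> \<psi> (eta \<psi> t)" using classM_antimono[OF M, of "eta \<psi> t" t] 2 by auto
    with 1 pos show False by simp
  qed
qed

lemma classM_plus_inf_D:
  assumes "\<psi> \<in> classM_plus_inf"
  shows "\<psi> \<in> classM" "1 \<le> x \<Longrightarrow> x \<le> y \<Longrightarrow> mu \<psi> x \<le> mu \<psi> y"
  using assms by (auto simp: classM_plus_inf_def monotone_on_def)

lemma eta_minus_eq:
  assumes "\<psi> \<in> classM" "1 \<le> t"
  shows "eta \<psi> t - t = t / mu \<psi> t" "mu \<psi> t > 0"
  using eta_gt[OF assms] assms(2) by (auto simp: mu_def)

text \<open>\<open>eta \<psi> y - y = y / mu \<psi> y\<close>, and replacing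
  \<open>mu \<psi> y\<close> by the smaller \<open>mu \<psi> x\<close> leaves a linear function of
  \<open>y\<close>.\<close>

lemma eta_growth:
  assumes P: "\<psi> \<in> classM_plus_inf" and t: "1 \<le> x" "x \<le> y"
  shows "eta \<psi> y - y \<le> eta \<psi> x - x + (y - x) / mu \<psi> x"
proof -
  note M = classM_plus_inf_D(1)[OF P]
  have "eta \<psi> y - y = y / mu \<psi> y" using eta_minus_eq[OF M, of y] t by simp
  also have "\<dots> \<le> y / mu \<psi> x"
    using classM_plus_inf_D(2)[OF P t] eta_minus_eq(2)[OF M, of x] t by (intro divide_left_mono) auto
  also have "\<dots> = x / mu \<psi> x + (y - x) / mu \<psi> x" by (simp add: diff_divide_distrib)
  also have "x / mu \<psi> x = eta \<psi> x - x" using eta_minus_eq[OF M, of x] t by simp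
  finally show ?thesis by simp
qed

text \<open>Convexity alone bounds the first unit step only from below. For the upper bound,
  \<open>eta\<close> carries the step from \<open>t\<close> to \<open>t + 1\<close> to an interval
  of length at most \<open>1 + 1 / mu \<psi> t\<close> on which \<psi> drops by half as much, and
  that interval lies to the right of the chord from \<open>t\<close> to \<open>eta \<psi> t\<close>,
  so \<psi> is flatter there.\<close>

lemma psi_step_upper:
  assumes P: "\<psi> \<in> classM_plus_inf" and t: "1 \<le> t"
  shows "\<psi> t - \<psi> (t + 1) \<le> \<psi> t / (eta \<psi> t - t) * (1 + 1 / mu \<psi> t)"
proof -
  note M = classM_plus_inf_D(1)[OF P]
  have e1: "\<psi> (eta \<psi> t) = \<psi> t / 2" "\<psi> (eta \<psi> (t+1)) = \<psi> (t+1) / 2"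
    using psi_eta[OF M] t by auto
  have lt: "t < eta \<psi> t" using eta_gt[OF M t] .
  have "\<psi> (eta \<psi> (t+1)) < \<psi> (eta \<psi> t)"
    using e1 classM_strict_decreasing[OF M t, of "t+1"] by simp
  then have lt2: "eta \<psi> t < eta \<psi> (t+1)"
    using classM_antimono[OF M, of "eta \<psi> (t+1)" "eta \<psi> t"] eta_gt[OF M, of "t+1"] t by fastforce
  have "(\<psi> (eta \<psi> t) - \<psi> (eta \<psi> (t+1))) / (eta \<psi> (t+1) - eta \<psi> t) \<le> (\<psi> t - \<psi> (eta \<psi> t)) / (eta \<psi> t - t)"
    using t lt lt2 by (intro convex_on_secant_decrease[OF classM_D(3)[OF M]]) auto
  then have "\<psi> (eta \<psi> t) - \<psi> (eta \<psi> (t+1)) \<le> (\<psi> t - \<psi> (eta \<psi> t)) / (eta \<psi> t - t) * (eta \<psi> (t+1) - eta \<psi> t)"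
    using lt2 by (simp add: pos_divide_le_eq)
  moreover have "(A - A/2) / D * E = A / D * E / 2" for A D E :: real by simp
  ultimately have "\<psi> t - \<psi> (t+1) \<le> \<psi> t / (eta \<psi> t - t) * (eta \<psi> (t+1) - eta \<psi> t)"
    unfolding e1 by (metis diff_divide_distrib divide_le_cancel zero_less_numeral not_less_iff_gr_or_eq)
  also have "\<dots> \<le> \<psi> t / (eta \<psi> t - t) * (1 + 1 / mu \<psi> t)"
    using eta_growth[OF P t, of "t+1"] lt classM_D(1)[OF M t]
    by (intro mult_left_mono) auto
  finally show ?thesis .
qed

text \<open>The potential \<open>\<psi> t * (\<eta> t - t + 1)\<close> drops by a fixed fraction of \<open>\<psi> t\<close> in each unit step,
  which gives a telescoping bound for the tail sums of \<open>\<psi>\<close>.\<close>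

lemma psi_potential_step:
  assumes P: "\<psi> \<in> classM_plus_inf" and t: "1 \<le> t" and b: "b > 2" "mu \<psi> t \<ge> b"
  shows "\<psi> t * (1/2 - 1/b) \<le> \<psi> t * (eta \<psi> t - t + 1) - \<psi> (t + 1) * (eta \<psi> (t+1) - (t+1) + 1)"
proof -
  note M = classM_plus_inf_D(1)[OF P]
  define h where "h = eta \<psi> t - t"
  have h: "h > 0" using eta_gt[OF M t] by (simp add: h_def)
  have pos: "\<psi> (t+1) > 0" using classM_D(1)[OF M] t by auto
  have less: "\<psi> (t+1) < \<psi> t" using classM_strict_decreasing[OF M t] by simp
  have "1 / mu \<psi> t \<le> 1 / b" using b by (intro divide_left_mono) auto
  then have "eta \<psi> (t+1) - (t+1) + 1 \<le> h + 1 + 1 / b"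
    using eta_growth[OF P t, of "t+1"] by (simp add: h_def)
  then have "\<psi> (t+1) * (eta \<psi> (t+1) - (t+1) + 1) \<le> \<psi> (t+1) * (h + 1 + 1/b)"
    using pos by (intro mult_left_mono) auto
  also have "\<dots> \<le> \<psi> (t+1) * (h+1) + \<psi> t / b"
    using less b by (simp add: distrib_left divide_right_mono)
  finally have 1: "\<psi> (t+1) * (eta \<psi> (t+1) - (t+1) + 1) \<le> \<psi> (t+1) * (h+1) + \<psi> t / b" .
  \<comment> \<open>For \<open>h \<ge> 1\<close> the first unit step is at least as steep as the
    chord to \<open>eta \<psi> t\<close>. For \<open>h < 1\<close> the function halves within the
    unit step, and the summand 1 in the potential is there to cover this case.\<close>
  have 2: "\<psi> t / 2 \<le> (\<psi> t - \<psi> (t+1)) * (h+1)"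
  proof (cases "h \<ge> 1")
    case True
    have "(\<psi> t - \<psi> (eta \<psi> t)) / (eta \<psi> t - t) \<le> (\<psi> t - \<psi> (t+1)) / (t + 1 - t)"
      using t h True by (intro convex_on_secant_decrease[OF classM_D(3)[OF M]]) (auto simp: h_def)
    then have "\<psi> t / 2 / h \<le> \<psi> t - \<psi> (t+1)" using psi_eta[OF M t] by (simp add: h_def)
    then have "\<psi> t / 2 \<le> (\<psi> t - \<psi> (t+1)) * h" using h by (simp add: pos_divide_le_eq)
    also have "\<dots> \<le> (\<psi> t - \<psi> (t+1)) * (h+1)" using less by (intro mult_left_mono) auto
    finally show ?thesis .
  next
    case False
    then have "\<psi> (t+1) \<le> \<psi> (eta \<psi> t)"
      using t h by (intro classM_antimono[OF M]) (auto simp: h_def)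
    then have "\<psi> t / 2 \<le> (\<psi> t - \<psi> (t+1)) * 1" using psi_eta[OF M t] by simp
    also have "\<dots> \<le> (\<psi> t - \<psi> (t+1)) * (h+1)" using less h by (intro mult_left_mono) auto
    finally show ?thesis .
  qed
  from 1 2 show ?thesis by (simp add: algebra_simps h_def)
qed

text \<open>In each step halving gains \<open>1/2\<close> and the growth of
  \<open>eta \<psi> t - t\<close> loses at most \<open>1/b\<close>; the net gain is positive because
  \<open>b > 2\<close>, and its reciprocal is the factor \<open>2 * b / (b - 2)\<close>.
  Monotonicity of \<open>mu\<close> carries the bound \<open>b\<close> along all
  \<open>t + j\<close>.\<close>

lemma psi_partial_sum_bound:
  assumes P: "\<psi> \<in> classM_plus_inf" and t: "1 \<le> t" and b: "b > 2" "mu \<psi> t \<ge> b"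
  shows "(\<Sum>j<N. \<psi> (t + real j)) \<le> 2 * b / (b - 2) * \<psi> t * (eta \<psi> t - t + 1)"
proof -
  note M = classM_plus_inf_D(1)[OF P]
  define W where "W u = \<psi> u * (eta \<psi> u - u + 1)" for u
  have W0: "W u \<ge> 0" if "u \<ge> 1" for u
    using classM_D(1)[OF M that] eta_gt[OF M that] by (simp add: W_def)
  have step: "\<psi> (t + real j) * (1/2 - 1/b) \<le> W (t + real j) - W (t + real (Suc j))" for j
  proof -
    have "mu \<psi> (t + real j) \<ge> b" using classM_plus_inf_D(2)[OF P, of t "t + real j"] b t by simp
    then show ?thesis
      using psi_potential_step[OF P, of "t + real j" b] t b by (simp add: W_def algebra_simps)
  qed
  have "(\<Sum>j<N. \<psi> (t + real j)) * (1/2 - 1/b) \<le> (\<Sum>j<N. W (t + real j) - W (t + real (Suc j)))"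
    unfolding sum_distrib_right by (intro sum_mono step)
  also have "\<dots> = W t - W (t + real N)"
    by (subst sum_lessThan_telescope') simp
  also have "\<dots> \<le> W t" using W0[of "t + real N"] t by simp
  finally have "(\<Sum>j<N. \<psi> (t + real j)) * (1/2 - 1/b) \<le> W t" .
  moreover have "1/2 - 1/b = (b - 2) / (2 * b)" using b by (simp add: field_simps)
  ultimately show ?thesis using b by (simp add: W_def field_simps)
qed

section \<open>Uniqueness of Fourier coefficients of integrable functions\<close>

lemma has_integral_cos_period:
  "((\<lambda>t. cos (of_int k * t + \<alpha>)) has_integral (if k = 0 then 2 * pi * cos \<alpha> else 0)) {a..a + 2*pi}"
proof (cases "k = 0")
  case True
  then show ?thesis using has_integral_const_real[of "cos \<alpha>" a "a + 2*pi"] by simp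
next
  case False
  have "((\<lambda>t. cos (of_int k * t + \<alpha>)) has_integral
      (sin (of_int k * (a + 2*pi) + \<alpha>) / of_int k - sin (of_int k * a + \<alpha>) / of_int k)) {a..a + 2*pi}"
    using False
    by (intro fundamental_theorem_of_calculus)
       (auto intro!: derivative_eq_intros simp flip: has_real_derivative_iff_has_vector_derivative)
  moreover have "sin (of_int k * (a + 2*pi) + \<alpha>) = sin (of_int k * a + \<alpha>)"
  proof -
    have "of_int k * (a + 2*pi) + \<alpha> = (of_int k * a + \<alpha>) + 2 * pi * of_int k"
      by (simp add: algebra_simps)
    then show ?thesis
      using sin_add[of "of_int k * a + \<alpha>" "2 * pi * of_int k"] by (simp only: sin_int_2pin cos_int_2pin)
  qed
  ultimately show ?thesis using False by simp
qed

text \<open>A free phase and an integer frequency cover sines, cosines and constants in one shape,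
  so that closure under products needs a single product-to-sum formula.\<close>

inductive trig_sum :: "(real \<Rightarrow> real) \<Rightarrow> bool" where
  base: "trig_sum (\<lambda>t. A * cos (of_int k * t + \<alpha>))"
| add: "trig_sum f \<Longrightarrow> trig_sum g \<Longrightarrow> trig_sum (\<lambda>t. f t + g t)"

lemma trig_sum_mult_base:
  assumes "trig_sum g"
  shows "trig_sum (\<lambda>t. A * cos (of_int k * t + \<alpha>) * g t)"
  using assms
proof induction
  case (base B l \<beta>)
  have "A * cos (of_int k * t + \<alpha>) * (B * cos (of_int l * t + \<beta>)) =
      (A*B/2) * cos (of_int (k - l) * t + (\<alpha> - \<beta>)) + (A*B/2) * cos (of_int (k + l) * t + (\<alpha> + \<beta>))" for t
  proof -
    have "of_int (k - l) * t + (\<alpha> - \<beta>) = (of_int k * t + \<alpha>) - (of_int l * t + \<beta>)"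
      "of_int (k + l) * t + (\<alpha> + \<beta>) = (of_int k * t + \<alpha>) + (of_int l * t + \<beta>)"
      by (simp_all add: algebra_simps)
    then show ?thesis by (simp only: cos_diff cos_add) (simp add: field_simps)
  qed
  then show ?case
    using trig_sum.add[OF trig_sum.base[of "A*B/2" "k-l" "\<alpha> - \<beta>"] trig_sum.base[of "A*B/2" "k+l" "\<alpha> + \<beta>"]]
    by presburger
next
  case (add f g)
  then show ?case by (auto simp: distrib_left intro: trig_sum.intros)
qed

lemma trig_sum_mult: "trig_sum f \<Longrightarrow> trig_sum g \<Longrightarrow> trig_sum (\<lambda>t. f t * g t)"
proof (induction rule: trig_sum.induct)
  case (base A k \<alpha>)
  then show ?case by (rule trig_sum_mult_base)
next
  case (add f1 f2)
  then show ?case by (auto simp: distrib_right intro: trig_sum.intros)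
qed

text \<open>This connects Stone-Weierstrass with Fourier coefficients: a linear functional on the
  circle is a combination of \<open>cos\<close> and \<open>sin\<close>, and sums and products stay
  within \<open>trig_sum\<close>.\<close>

lemma trig_sum_cis_polynomial:
  assumes "real_polynomial_function (p :: complex \<Rightarrow> real)"
  shows "trig_sum (\<lambda>t. p (cis t))"
  using assms
proof induction
  case (linear f)
  then interpret bounded_linear f .
  have "f (cis t) = f 1 * cos (of_int 1 * t + 0) + f \<i> * cos (of_int 1 * t + (- pi/2))" for t
  proof -
    have "cis t = cos t *\<^sub>R 1 + sin t *\<^sub>R \<i>" by (simp add: complex_eq_iff)
    then have "f (cis t) = cos t * f 1 + sin t * f \<i>" by (simp only: add scaleR) simp
    moreover have "cos (t - pi/2) = sin t" by (simp add: cos_diff)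
    ultimately show ?thesis by simp
  qed
  then show ?case
    using trig_sum.add[OF trig_sum.base[of "f 1" 1 0] trig_sum.base[of "f \<i>" 1 "- pi/2"]] by presburger
next
  case (const c)
  then show ?case using trig_sum.base[of c 0 0] by simp
qed (auto intro: trig_sum.add trig_sum_mult)

lemma set_integrable_mult_continuous:
  fixes h g :: "real \<Rightarrow> real"
  assumes "set_integrable lebesgue {a..b} h" "continuous_on {a..b} g"
  shows "set_integrable lebesgue {a..b} (\<lambda>t. h t * g t)"
proof -
  have "set_integrable lebesgue {a..b} (\<lambda>t. g t * h t)"
    using assms
    by (intro absolutely_integrable_bounded_measurable_product_real)
       (auto intro!: continuous_imp_measurable_on_sets_lebesgue compact_imp_bounded compact_continuous_image)
  then show ?thesis by (simp add: mult.commute)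
qed

lemma trig_sum_continuous: "trig_sum g \<Longrightarrow> continuous_on S g"
  by (induction rule: trig_sum.induct) (auto intro!: continuous_intros)

lemma trig_sum_orthogonal:
  fixes h :: "real \<Rightarrow> real"
  assumes h: "set_integrable lebesgue {a..b} h"
    and c: "\<And>k::nat. (LINT t:{a..b}|lebesgue. h t * cos (real k * t)) = 0"
    and s: "\<And>k::nat. (LINT t:{a..b}|lebesgue. h t * sin (real k * t)) = 0"
    and "trig_sum g"
  shows "(LINT t:{a..b}|lebesgue. h t * g t) = 0"
  using assms(4)
proof induction
  case (base A k \<alpha>)
  define n where "n = nat \<bar>k\<bar>"
  have eq: "h t * (A * cos (of_int k * t + \<alpha>)) =
      (A * cos \<alpha>) * (h t * cos (real n * t)) + (- (A * sin \<alpha> * sgn (of_int k))) * (h t * sin (real n * t))" for t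
    by (cases "k \<ge> 0") (auto simp: n_def cos_add algebra_simps sgn_if)
  have i1: "set_integrable lebesgue {a..b} (\<lambda>t. h t * cos (real n * t))"
    and i2: "set_integrable lebesgue {a..b} (\<lambda>t. h t * sin (real n * t))"
    by (intro set_integrable_mult_continuous h continuous_intros)+
  show ?case unfolding eq
    by (subst set_integral_add)
       (use i1 i2 in \<open>simp_all only: set_integrable_mult_right set_integral_mult_right c s mult_zero_right add_0\<close>)
next
  case (add f g)
  then show ?case unfolding distrib_left
    by (subst set_integral_add) (auto intro!: set_integrable_mult_continuous h trig_sum_continuous)
qed

text \<open>Test functions live on the circle because only periodic functions are uniform limits of
  trigonometric polynomials. The uniform error is paid for by the integral \<open>J\<close> of
  \<open>\<bar>h t\<bar>\<close>; dividing by \<open>J + 1\<close> also covers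
  \<open>J = 0\<close>.\<close>

lemma circle_continuous_orthogonal:
  fixes h :: "real \<Rightarrow> real" and G :: "complex \<Rightarrow> real"
  assumes h: "set_integrable lebesgue {a..b} h"
    and T: "\<And>g. trig_sum g \<Longrightarrow> (LINT t:{a..b}|lebesgue. h t * g t) = 0"
    and G: "continuous_on (sphere 0 1) G"
  shows "(LINT t:{a..b}|lebesgue. h t * G (cis t)) = 0"
proof -
  define J where "J = (LINT t:{a..b}|lebesgue. \<bar>h t\<bar>)"
  have cG: "continuous_on {a..b} (\<lambda>t. G (cis t))"
    by (rule continuous_on_compose2[OF G]) (auto intro!: continuous_intros simp: cis_conv_exp)
  have J0: "J \<ge> 0" unfolding J_def set_lebesgue_integral_def by (intro integral_nonneg_AE) auto
  have "\<bar>LINT t:{a..b}|lebesgue. h t * G (cis t)\<bar> \<le> e" if e: "e > 0" for e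
  proof -
    obtain p where p: "real_polynomial_function p" "\<And>x. x \<in> sphere 0 1 \<Longrightarrow> \<bar>G x - p x\<bar> < e / (J+1)"
      using Stone_Weierstrass_real_polynomial_function[OF compact_sphere G, of "e/(J+1)"] e J0
      by (metis add_nonneg_pos divide_pos_pos zero_less_one)
    note tp = trig_sum_cis_polynomial[OF p(1)]
    note cp = trig_sum_continuous[OF tp, of "{a..b}"]
    have ih: "set_integrable lebesgue {a..b} (\<lambda>t. \<bar>h t\<bar>)" by (rule set_integrable_abs[OF h])
    have "(LINT t:{a..b}|lebesgue. h t * G (cis t)) = (LINT t:{a..b}|lebesgue. h t * (G (cis t) - p (cis t)))"
      unfolding right_diff_distrib
      by (subst set_integral_diff) (auto intro!: set_integrable_mult_continuous h cG cp simp: T[OF tp])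
    also have "\<bar>\<dots>\<bar> \<le> (LINT t:{a..b}|lebesgue. \<bar>h t * (G (cis t) - p (cis t))\<bar>)"
      using set_integral_norm_bound[of lebesgue "{a..b}" "\<lambda>t. h t * (G (cis t) - p (cis t))",
          OF set_integrable_mult_continuous[OF h continuous_on_diff[OF cG cp]]] by simp
    also have "\<dots> \<le> (LINT t:{a..b}|lebesgue. \<bar>h t\<bar> * (e / (J+1)))"
    proof (rule set_integral_mono)
      show "set_integrable lebesgue {a..b} (\<lambda>t. \<bar>h t * (G (cis t) - p (cis t))\<bar>)"
        by (intro set_integrable_abs set_integrable_mult_continuous h cG cp continuous_intros)
      show "set_integrable lebesgue {a..b} (\<lambda>t. \<bar>h t\<bar> * (e / (J+1)))"
        by (intro set_integrable_mult_left) (use ih in simp)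
      fix t
      have "cis t \<in> sphere 0 1" by simp
      from p(2)[OF this] show "\<bar>h t * (G (cis t) - p (cis t))\<bar> \<le> \<bar>h t\<bar> * (e / (J+1))"
        unfolding abs_mult by (intro mult_left_mono) auto
    qed
    also have "\<dots> = J * (e / (J+1))" by (simp add: J_def)
    also have "\<dots> \<le> e" using e J0 by (simp add: field_simps)
    finally show ?thesis .
  qed
  then show ?thesis by (meson abs_le_zero_iff field_le_epsilon add_0 dense_ge)
qed

text \<open>The indicator of \<open>C\<close> is the pointwise limit of continuous functions on the
  circle, and dominated convergence transfers orthogonality to it. \<open>C\<close> avoids the
  endpoints because \<open>0\<close> and \<open>2 * pi\<close> are the same point of the
  circle.\<close>

lemma Fourier_zero_closed:
  fixes h :: "real \<Rightarrow> real"
  assumes h: "set_integrable lebesgue {0..2*pi} h"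
    and T: "\<And>g. trig_sum g \<Longrightarrow> (LINT t:{0..2*pi}|lebesgue. h t * g t) = 0"
    and C: "closed C" "C \<subseteq> {0<..<2*pi}"
  shows "(LINT t:C|lebesgue. h t) = 0"
proof (cases "C = {}")
  case True
  then show ?thesis by (simp add: set_lebesgue_integral_def)
next
  case False
  have "compact C" using C bounded_subset[of "{0<..<2*pi}" C] by (auto simp: compact_eq_bounded_closed)
  have contcis: "continuous_on S cis" for S by (auto intro!: continuous_intros simp: cis_conv_exp)
  have cC: "compact (cis ` C)" by (intro compact_continuous_image contcis \<open>compact C\<close>)
  have cne: "cis ` C \<noteq> {}" using False by simp
  \<comment> \<open>Tents of height 1 on the image of \<open>C\<close> whose slopes steepen with
    \<open>j\<close>; off the image they are eventually 0.\<close>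
  define G where "G j z = max 0 (1 - real j * infdist z (cis ` C))" for j z
  have cG: "continuous_on S (G j)" for S j
    unfolding G_def by (intro continuous_intros)
  have G01: "0 \<le> G j z" "G j z \<le> 1" for j z by (auto simp: G_def infdist_nonneg)
  have z: "(LINT t:{0..2*pi}|lebesgue. h t * G j (cis t)) = 0" for j
    by (rule circle_continuous_orthogonal[OF h T cG])
  have inC: "cis t \<in> cis ` C \<longleftrightarrow> t \<in> C" if t: "t \<in> {0..2*pi}" for t
  proof
    assume "cis t \<in> cis ` C"
    then obtain u where u: "u \<in> C" "cis t = cis u" by auto
    then have "sin t = sin u" "cos t = cos u" by (simp_all add: complex_eq_iff)
    then obtain k :: int where k: "t = u + 2 * pi * of_int k" using sin_cos_eq_iff by metis
    have u': "0 < u" "u < 2*pi" using u C by auto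
    have "2 * pi * of_int k < 2 * pi * 1" "2 * pi * (-1) < 2 * pi * of_int k"
      using k t u' unfolding atLeastAtMost_iff by linarith+
    then have "real_of_int k < 1" "-1 < real_of_int k"
      using pi_gt_zero by (simp_all only: mult_less_cancel_left_pos mult_pos_pos zero_less_numeral)
    then have "k = 0" by linarith
    with k u show "t \<in> C" by simp
  qed auto
  have lim: "(\<lambda>j. G j (cis t)) \<longlonglongrightarrow> indicator C t" if t: "t \<in> {0..2*pi}" for t
  proof (cases "t \<in> C")
    case True
    then have "infdist (cis t) (cis ` C) = 0" by simp
    then show ?thesis using True by (simp add: G_def)
  next
    case False
    then have "infdist (cis t) (cis ` C) > 0"
      using in_closed_iff_infdist_zero[OF compact_imp_closed[OF cC] cne] inC[OF t]
      by (metis infdist_nonneg less_eq_real_def)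
    define d where "d = infdist (cis t) (cis ` C)"
    have d: "d > 0" unfolding d_def by fact
    have "eventually (\<lambda>j. real j * d \<ge> 1) sequentially"
      using d by (auto intro!: eventually_sequentiallyI[of "nat \<lceil>1/d\<rceil>"] simp: pos_divide_le_eq[symmetric] nat_ceiling_le_eq)
    then have "eventually (\<lambda>j. G j (cis t) = 0) sequentially"
      by eventually_elim (auto simp: G_def d_def)
    then show ?thesis using False by (simp add: tendsto_eventually)
  qed
  have "(\<lambda>j. LINT t:{0..2*pi}|lebesgue. h t * G j (cis t)) \<longlonglongrightarrow> (LINT t:{0..2*pi}|lebesgue. h t * indicator C t)"
    unfolding set_lebesgue_integral_def
  proof (rule integral_dominated_convergence[where w = "\<lambda>t. indicator {0..2*pi} t * \<bar>h t\<bar>"])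
    have Cm: "C \<in> sets lebesgue" using C(1) by simp
    have m: "(\<lambda>t. indicator {0..2*pi} t *\<^sub>R h t) \<in> borel_measurable lebesgue"
      using h by (simp add: set_integrable_def)
    show "(\<lambda>t. indicator {0..2*pi} t *\<^sub>R (h t * indicator C t)) \<in> borel_measurable lebesgue"
    proof -
      have "(\<lambda>t. (indicator {0..2*pi} t *\<^sub>R h t) * indicator C t) \<in> borel_measurable lebesgue"
        using m Cm by (intro borel_measurable_times) auto
      then show ?thesis by (simp add: mult.assoc)
    qed
    show "(\<lambda>t. indicator {0..2*pi} t *\<^sub>R (h t * G j (cis t))) \<in> borel_measurable lebesgue" for j
      using set_integrable_mult_continuous[OF h, of "\<lambda>t. G j (cis t)"]
        continuous_on_compose2[OF cG contcis subset_UNIV]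
      by (auto simp: set_integrable_def)
    show "integrable lebesgue (\<lambda>t. indicator {0..2*pi} t * \<bar>h t\<bar>)"
      using h set_integrable_abs[OF h] by (simp add: set_integrable_def)
    show "AE t in lebesgue. (\<lambda>j. indicator {0..2*pi} t *\<^sub>R (h t * G j (cis t)))
        \<longlonglongrightarrow> indicator {0..2*pi} t *\<^sub>R (h t * indicator C t)"
    proof (rule AE_I2)
      fix t
      show "(\<lambda>j. indicator {0..2*pi} t *\<^sub>R (h t * G j (cis t))) \<longlonglongrightarrow> indicator {0..2*pi} t *\<^sub>R (h t * indicator C t)"
        using tendsto_mult[OF tendsto_const[of "h t"] lim[of t]] by (cases "t \<in> {0..2*pi}") simp_all
    qed
    show "AE t in lebesgue. norm (indicator {0..2*pi} t *\<^sub>R (h t * G j (cis t))) \<le> indicator {0..2*pi} t * \<bar>h t\<bar>" for j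
      using G01[of j] by (intro AE_I2) (auto simp: indicator_def abs_mult intro!: mult_left_le)
  qed
  then have "(LINT t:{0..2*pi}|lebesgue. h t * indicator C t) = 0"
    using z by (simp add: LIMSEQ_const_iff)
  also have "(LINT t:{0..2*pi}|lebesgue. h t * indicator C t) = (LINT t:C|lebesgue. h t)"
    unfolding set_lebesgue_integral_def using C(2)
    by (intro Bochner_Integration.integral_cong) (auto simp: indicator_def)
  finally show ?thesis .
qed

text \<open>If \<open>h\<close> were positive on a set of positive measure, inner regularity would
  give a closed subset that is not null, and the integral of \<open>h\<close> over it would be
  positive.\<close>

lemma AE_nonpos_if_closed_integrals_zero:
  fixes h :: "real \<Rightarrow> real"
  assumes h: "set_integrable lebesgue {a..b} h"
    and C: "\<And>C. closed C \<Longrightarrow> C \<subseteq> {a<..<b} \<Longrightarrow> (LINT t:C|lebesgue. h t) = 0"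
  shows "AE t in lebesgue. t \<in> {a<..<b} \<longrightarrow> h t \<le> 0"
proof -
  define A where "A = {t \<in> {a<..<b}. h t > 0}"
  have m: "(\<lambda>t. indicator {a..b} t *\<^sub>R h t) \<in> borel_measurable lebesgue"
    using h by (simp add: set_integrable_def)
  have "A = {a<..<b} \<inter> {t \<in> space lebesgue. indicator {a..b} t *\<^sub>R h t > 0}"
    by (auto simp: A_def indicator_def split: if_splits)
  also have "\<dots> \<in> sets lebesgue" using m by (intro sets.Int borel_measurable_less) auto
  finally have A: "A \<in> sets lebesgue" .
  have "emeasure lebesgue A = 0"
  proof (rule ccontr)
    assume ne: "emeasure lebesgue A \<noteq> 0"
    have fin: "emeasure lebesgue A < \<infinity>"
    proof -
      have "emeasure lebesgue A \<le> emeasure lebesgue {a..b}"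
        by (rule emeasure_mono) (auto simp: A_def)
      also have "\<dots> < \<infinity>" using emeasure_bounded_finite[of "{a..b}"] by simp
      finally show ?thesis .
    qed
    then have pos: "measure lebesgue A > 0" 
      using ne by (simp add: measure_def enn2real_positive_iff zero_less_iff_neq_zero)
    \<comment> \<open>Missing less than the full measure of \<open>A\<close> is just enough to keep
      \<open>T\<close> from being a null set.\<close>
    obtain T where T: "closed T" "T \<subseteq> A" "emeasure lebesgue (A - T) < ennreal (measure lebesgue A)"
      using sets_lebesgue_inner_closed[OF A pos] by metis
    have Tm: "T \<in> sets lebesgue" using T(1) by simp
    have Tne: "emeasure lebesgue T \<noteq> 0"
    proof
      assume "emeasure lebesgue T = 0"
      then have "emeasure lebesgue (A - T) = emeasure lebesgue A"
        using A Tm by (intro emeasure_Diff_null_set) (auto simp: null_sets_def)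
      with T(3) show False using fin by (simp add: emeasure_eq_ennreal_measure)
    qed
    have Ti: "set_integrable lebesgue T h"
      using set_integrable_subset[OF h, of T] Tm T(2) by (force simp: A_def)
    have "T \<subseteq> {a<..<b}" using T(2) unfolding A_def by blast
    then have "(LINT t:T|lebesgue. h t) = 0" by (rule C[OF T(1)])
    moreover have "AE t in lebesgue. 0 \<le> indicator T t *\<^sub>R h t"
      using T(2) by (intro AE_I2) (auto simp: A_def indicator_def)
    ultimately have "AE t in lebesgue. indicator T t *\<^sub>R h t = 0"
      using Ti unfolding set_lebesgue_integral_def set_integrable_def
      by (simp add: integral_nonneg_eq_0_iff_AE)
    then have "AE t in lebesgue. t \<notin> T"
      by eventually_elim (use T(2) in \<open>auto simp: A_def indicator_def split: if_splits\<close>)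
    then have "emeasure lebesgue T = 0" using completion.null_sets_iff_AE[of T lborel] by (intro null_setsD1) auto
    with Tne show False ..
  qed
  then have "AE t in lebesgue. t \<notin> A" using A by (intro AE_not_in) (auto simp: null_sets_def)
  then show ?thesis by eventually_elim (auto simp: A_def)
qed

lemma Fourier_uniqueness:
  fixes h :: "real \<Rightarrow> real"
  assumes h: "set_integrable lebesgue {0..2*pi} h"
    and c: "\<And>k::nat. (LINT t:{0..2*pi}|lebesgue. h t * cos (real k * t)) = 0"
    and s: "\<And>k::nat. (LINT t:{0..2*pi}|lebesgue. h t * sin (real k * t)) = 0"
  shows "AE t in lebesgue. t \<in> {0..2*pi} \<longrightarrow> h t = 0"
proof -
  have C: "(LINT t:C|lebesgue. h t) = 0" if "closed C" "C \<subseteq> {0<..<2*pi}" for C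
    using Fourier_zero_closed[OF h trig_sum_orthogonal[OF h c s] that] .
  have 1: "AE t in lebesgue. t \<in> {0<..<2*pi} \<longrightarrow> h t \<le> 0"
    by (rule AE_nonpos_if_closed_integrals_zero[OF h C])
  have 2: "AE t in lebesgue. t \<in> {0<..<2*pi} \<longrightarrow> - h t \<le> 0"
    by (rule AE_nonpos_if_closed_integrals_zero) (use h C in \<open>auto simp: set_integrable_def set_lebesgue_integral_def\<close>)
  have 3: "AE t in lebesgue. t \<notin> {0, 2*pi}"
    by (intro AE_not_in null_sets_completionI finite_imp_null_set_lborel) auto
  from 1 2 3 show ?thesis by eventually_elim auto
qed

section \<open>Periodic functions and cosine series\<close>

lemma periodic2pi_int: "periodic2pi f \<Longrightarrow> f (x + 2 * pi * of_int j) = f x"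
proof (induction j rule: int_induct[where k = 0])
  case (step1 i)
  then have "f (x + 2 * pi * of_int i + 2 * pi) = f x" by (simp add: periodic2pi_def)
  then show ?case by (simp add: algebra_simps)
next
  case (step2 i)
  then have "f (x + 2 * pi * of_int (i - 1) + 2 * pi) = f (x + 2 * pi * of_int (i - 1))"
    by (simp only: periodic2pi_def)
  moreover have "x + 2 * pi * of_int (i - 1) + 2 * pi = x + 2 * pi * of_int i"
    by (simp add: algebra_simps)
  ultimately show ?case using step2 by metis
qed simp

text \<open>With \<open>d\<close> the representative of \<open>a\<close> modulo
  \<open>2 * pi\<close>, the piece over \<open>{0..d}\<close> is cut off and appended after
  \<open>2 * pi\<close>; the resulting period interval is then moved by a multiple of the
  period.\<close>

lemma periodic_has_integral_shift:
  fixes f :: "real \<Rightarrow> real"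
  assumes per: "periodic2pi f" and I: "(f has_integral I) {0..2*pi}"
  shows "(f has_integral I) {a..a + 2*pi}"
proof -
  have shift: "(f has_integral J) {u..v} \<longleftrightarrow> (f has_integral J) {u + 2*pi* of_int j..v + 2*pi* of_int j}" for u v J j
  proof -
    have "f \<circ> ((+) (2*pi* of_int j)) = f" using periodic2pi_int[OF per] by (auto simp: fun_eq_iff add.commute)
    then show ?thesis using has_integral_shift_Icc_real[of f "2*pi* of_int j" J u v] by simp
  qed
  define j where "j = \<lfloor>a / (2*pi)\<rfloor>"
  define d where "d = a - 2*pi* of_int j"
  have "of_int j \<le> a / (2*pi)" "a / (2*pi) < of_int j + 1" unfolding j_def by linarith+
  then have d: "0 \<le> d" "d \<le> 2*pi" by (auto simp: d_def field_simps)
  have int: "f integrable_on {0..2*pi}" using I by blast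
  have i1: "f integrable_on {0..d}" and i2: "f integrable_on {d..2*pi}"
    using d by (auto intro: integrable_on_subinterval[OF int])
  have "(f has_integral (integral {0..d} f + integral {d..2*pi} f)) {0..2*pi}"
    by (rule has_integral_combine[OF d integrable_integral[OF i1] integrable_integral[OF i2]])
  from has_integral_unique[OF I this]
  have Ieq: "I = integral {d..2*pi} f + integral {0..d} f" by simp
  have "(f has_integral (integral {0..d} f)) {2*pi..d + 2*pi}"
    using shift[of "integral {0..d} f" 0 d 1] integrable_integral[OF i1] by simp
  then have "(f has_integral I) {d..d + 2*pi}"
    unfolding Ieq using d by (intro has_integral_combine[OF _ _ integrable_integral[OF i2]]) auto
  then show ?thesis using shift[of I d "d + 2*pi" j] by (simp add: d_def algebra_simps)
qed

lemma periodic_set_integrable_shift: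
  fixes f :: "real \<Rightarrow> real"
  assumes per: "periodic2pi f" and f: "set_integrable lebesgue {0..2*pi} f"
  shows "set_integrable lebesgue {a..a + 2*pi} f"
    and "(LINT t:{a..a + 2*pi}|lebesgue. f t) = (LINT t:{0..2*pi}|lebesgue. f t)"
proof -
  have "periodic2pi (\<lambda>x. norm (f x))" using per by (simp add: periodic2pi_def)
  then show i: "set_integrable lebesgue {a..a + 2*pi} f"
    using f periodic_has_integral_shift[OF per, of _ a] periodic_has_integral_shift[of "\<lambda>x. norm (f x)" _ a]
    unfolding absolutely_integrable_on_def by (meson integrable_on_def)
  show "(LINT t:{a..a + 2*pi}|lebesgue. f t) = (LINT t:{0..2*pi}|lebesgue. f t)"
    using periodic_has_integral_shift[OF per has_integral_set_lebesgue[OF f], of a] has_integral_set_lebesgue[OF i]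
    by (rule has_integral_unique[symmetric])
qed

lemma AE_lebesgue_iff_negligible: "(AE t in lebesgue. P t) \<longleftrightarrow> negligible {t. \<not> P t}"
  using completion.AE_iff_null_sets[of P lborel] by (simp add: negligible_iff_null_sets)

text \<open>Reflection is Lipschitz and so preserves null sets. It allows the kernel of a
  convolution to be changed on a null set for every \<open>x\<close>, not only for almost every
  one.\<close>

lemma AE_lebesgue_reflect:
  fixes x :: real
  assumes "AE t in lebesgue. P t"
  shows "AE t in lebesgue. P (x - t)"
proof -
  have "negligible ((\<lambda>t. x - t) ` {t. \<not> P t})"
    using assms unfolding AE_lebesgue_iff_negligible
    by (intro negligible_locally_Lipschitz_image) (auto intro!: exI[of _ "UNIV :: real set"] exI[of _ "1 :: real"])
  moreover have "(\<lambda>t. x - t) ` {t. \<not> P t} = {t. \<not> P (x - t)}"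
    by (auto simp: image_iff intro!: exI[of _ "x - _"])
  ultimately show ?thesis by (simp add: AE_lebesgue_iff_negligible)
qed

lemma AE_lebesgue_periodic:
  assumes per: "\<And>t. P (t + 2*pi) \<longleftrightarrow> P t"
    and AE: "AE t in lebesgue. t \<in> {0..2*pi} \<longrightarrow> P t"
  shows "AE t in lebesgue. P t"
proof -
  have "periodic2pi (\<lambda>t. if P t then 1 else 0)" by (auto simp: periodic2pi_def per)
  from periodic2pi_int[OF this] have perj: "P (t + 2 * pi * of_int j) \<longleftrightarrow> P t" for t j
    by (metis zero_neq_one)
  define N where "N = {t. \<not> (t \<in> {0..2*pi} \<longrightarrow> P t)}"
  have "negligible N" using AE unfolding AE_lebesgue_iff_negligible N_def .
  then have "negligible (\<Union>j::int. (+) (2 * pi * of_int j) ` N)"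
    by (intro negligible_countable_Union) (auto intro: negligible_translation)
  moreover have "{t. \<not> P t} \<subseteq> (\<Union>j::int. (+) (2 * pi * of_int j) ` N)"
  proof safe
    fix t assume t: "\<not> P t"
    define j where "j = \<lfloor>t / (2*pi)\<rfloor>"
    define d where "d = t - 2*pi* of_int j"
    have "of_int j \<le> t / (2*pi)" "t / (2*pi) < of_int j + 1" unfolding j_def by linarith+
    then have d: "0 \<le> d" "d \<le> 2*pi" by (auto simp: d_def field_simps)
    have "\<not> P d" using perj[of d j] t by (simp add: d_def)
    then have "d \<in> N" using d by (simp add: N_def)
    then show "t \<in> (\<Union>j::int. (+) (2 * pi * of_int j) ` N)"
      by (auto simp: d_def intro!: exI[of _ j] image_eqI[of _ _ d])
  qed
  ultimately show ?thesis unfolding AE_lebesgue_iff_negligible by (rule negligible_subset)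
qed

section \<open>Absolutely convergent cosine series with a common phase\<close>

definition cos_series :: "(nat \<Rightarrow> real) \<Rightarrow> real \<Rightarrow> real \<Rightarrow> real" where
  "cos_series c \<gamma> y = (\<Sum>k. c k * cos (real k * y - \<gamma>))"

lemma cos_series_uniform_limit:
  assumes "summable (\<lambda>k. \<bar>c k\<bar>)"
  shows "uniform_limit A (\<lambda>N y. \<Sum>k<N. c k * cos (real k * y - \<gamma>)) (cos_series c \<gamma>) sequentially"
  unfolding cos_series_def
  by (rule Weierstrass_m_test[OF _ assms]) (auto simp: abs_mult intro!: mult_left_le)

lemma cos_series_sums:
  assumes "summable (\<lambda>k. \<bar>c k\<bar>)"
  shows "(\<lambda>k. c k * cos (real k * y - \<gamma>)) sums cos_series c \<gamma> y"
  unfolding cos_series_def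
  by (rule summable_sums, rule summable_comparison_test'[OF assms, of 0])
     (auto simp: abs_mult intro!: mult_left_le)

lemma cos_series_continuous:
  assumes "summable (\<lambda>k. \<bar>c k\<bar>)"
  shows "continuous_on A (cos_series c \<gamma>)"
  by (rule uniform_limit_theorem[OF _ cos_series_uniform_limit[OF assms]])
     (auto intro!: always_eventually continuous_intros)

lemma cos_series_periodic: "periodic2pi (cos_series c \<gamma>)"
proof -
  have "cos (real k * (x + 2*pi) - \<gamma>) = cos (real k * x - \<gamma>)" for k x
  proof -
    have "real k * (x + 2*pi) - \<gamma> = (real k * x - \<gamma>) + 2 * pi * of_int (int k)" by (simp add: algebra_simps)
    then show ?thesis
      using cos_add[of "real k * x - \<gamma>" "2 * pi * of_int (int k)"] by (simp only: sin_int_2pin cos_int_2pin)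
  qed
  then show ?thesis by (simp add: periodic2pi_def cos_series_def)
qed

text \<open>The inner function \<theta> is kept general so that \<open>\<theta> t = t\<close> yields
  Fourier coefficients and \<open>\<theta> t = x - t\<close> yields convolutions.\<close>

lemma cos_series_integral_sums:
  fixes \<theta> w :: "real \<Rightarrow> real"
  assumes c: "summable (\<lambda>k. \<bar>c k\<bar>)" and \<theta>: "continuous_on {a..b} \<theta>" and w: "continuous_on {a..b} w"
  shows "(\<lambda>k. c k * integral {a..b} (\<lambda>t. cos (real k * \<theta> t - \<gamma>) * w t)) sums
    integral {a..b} (\<lambda>t. cos_series c \<gamma> (\<theta> t) * w t)"
proof -
  have bw: "bounded (w ` {a..b})" by (intro compact_imp_bounded compact_continuous_image w compact_Icc)
  have bc: "bounded ((\<lambda>t. cos_series c \<gamma> (\<theta> t)) ` {a..b})"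
    by (intro compact_imp_bounded compact_continuous_image compact_Icc
        continuous_on_compose2[OF cos_series_continuous[OF c, of UNIV] \<theta>] subset_UNIV)
  have "uniform_limit {a..b} (\<lambda>N t. \<Sum>k<N. c k * cos (real k * \<theta> t - \<gamma>)) (\<lambda>t. cos_series c \<gamma> (\<theta> t)) sequentially"
    using uniform_limit_compose'[OF cos_series_uniform_limit[OF c, where A = UNIV and \<gamma> = \<gamma>], of \<theta> "{a..b}"] by simp
  moreover have "uniform_limit {a..b} (\<lambda>N t. w t) w sequentially" by (rule uniform_limit_const)
  ultimately have u: "uniform_limit {a..b} (\<lambda>N t. (\<Sum>k<N. c k * cos (real k * \<theta> t - \<gamma>)) * w t)
      (\<lambda>t. cos_series c \<gamma> (\<theta> t) * w t) sequentially"
    by (rule uniform_lim_mult) (fact bc bw)+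
  have cont: "continuous_on {a..b} (\<lambda>t. (\<Sum>k<N. c k * cos (real k * \<theta> t - \<gamma>)) * w t)" for N
    by (intro continuous_intros w \<theta>)
  obtain I J where IJ: "\<And>N. ((\<lambda>t. (\<Sum>k<N. c k * cos (real k * \<theta> t - \<gamma>)) * w t) has_integral I N) {a..b}"
      "((\<lambda>t. cos_series c \<gamma> (\<theta> t) * w t) has_integral J) {a..b}" "I \<longlonglongrightarrow> J"
    using uniform_limit_integral[OF u cont sequentially_bot] by blast
  have "I N = (\<Sum>k<N. c k * integral {a..b} (\<lambda>t. cos (real k * \<theta> t - \<gamma>) * w t))" for N
  proof (rule has_integral_unique[OF IJ(1)])
    have "((\<lambda>t. \<Sum>k<N. c k * (cos (real k * \<theta> t - \<gamma>) * w t)) has_integral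
       (\<Sum>k<N. c k * integral {a..b} (\<lambda>t. cos (real k * \<theta> t - \<gamma>) * w t))) {a..b}"
      by (intro has_integral_sum has_integral_mult_right integrable_integral integrable_continuous_real
          continuous_intros w \<theta>) auto
    then show "((\<lambda>t. (\<Sum>k<N. c k * cos (real k * \<theta> t - \<gamma>)) * w t) has_integral
       (\<Sum>k<N. c k * integral {a..b} (\<lambda>t. cos (real k * \<theta> t - \<gamma>) * w t))) {a..b}"
      by (simp add: sum_distrib_right mult.assoc)
  qed
  then have "I = (\<lambda>N. \<Sum>k<N. c k * integral {a..b} (\<lambda>t. cos (real k * \<theta> t - \<gamma>) * w t))" by (rule ext)
  with IJ show ?thesis unfolding sums_def by (simp add: integral_unique)
qed

text \<open>Two free phases cover all products of sines and cosines at once. The condition on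
  \<open>j\<close> excludes \<open>k = j = 0\<close>, where the sum frequency would vanish as
  well.\<close>

lemma integral_cos_cos:
  fixes k j :: nat
  assumes "j \<ge> 1"
  shows "((\<lambda>t. cos (real k * t - \<gamma>) * cos (real j * t - \<delta>)) has_integral
    (if k = j then pi * cos (\<gamma> - \<delta>) else 0)) {a..a + 2*pi}"
proof -
  have eq: "cos (real k * t - \<gamma>) * cos (real j * t - \<delta>) =
     (cos (of_int (int k - int j) * t + (\<delta> - \<gamma>)) + cos (of_int (int k + int j) * t + (- \<gamma> - \<delta>))) / 2" for t
  proof -
    have "of_int (int k - int j) * t + (\<delta> - \<gamma>) = (real k * t - \<gamma>) - (real j * t - \<delta>)"
      "of_int (int k + int j) * t + (- \<gamma> - \<delta>) = (real k * t - \<gamma>) + (real j * t - \<delta>)"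
      by (simp_all add: algebra_simps)
    then show ?thesis by (simp only: cos_diff cos_add) simp
  qed
  have "((\<lambda>t. (cos (of_int (int k - int j) * t + (\<delta> - \<gamma>)) + cos (of_int (int k + int j) * t + (- \<gamma> - \<delta>))) / 2) has_integral
     ((if int k - int j = 0 then 2 * pi * cos (\<delta> - \<gamma>) else 0)
      + (if int k + int j = 0 then 2 * pi * cos (- \<gamma> - \<delta>) else 0)) / 2) {a..a + 2*pi}"
    by (intro has_integral_divide has_integral_add has_integral_cos_period)
  moreover have "cos (\<delta> - \<gamma>) = cos (\<gamma> - \<delta>)" using cos_minus[of "\<gamma> - \<delta>"] by simp
  ultimately show ?thesis unfolding eq using assms by (cases "k = j") simp_all
qed

lemma cos_series_coefficient:
  assumes c: "summable (\<lambda>k. \<bar>c k\<bar>)" and j: "j \<ge> 1"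
  shows "integral {a..a + 2*pi} (\<lambda>t. cos_series c \<gamma> t * cos (real j * t - \<delta>)) = pi * c j * cos (\<gamma> - \<delta>)"
proof -
  have "(\<lambda>k. c k * integral {a..a + 2*pi} (\<lambda>t. cos (real k * t - \<gamma>) * cos (real j * t - \<delta>))) sums
      integral {a..a + 2*pi} (\<lambda>t. cos_series c \<gamma> t * cos (real j * t - \<delta>))"
    by (intro cos_series_integral_sums c continuous_intros)
  moreover have "integral {a..a + 2*pi} (\<lambda>t. cos (real k * t - \<gamma>) * cos (real j * t - \<delta>)) =
      (if k = j then pi * cos (\<gamma> - \<delta>) else 0)" for k
    using integral_cos_cos[OF j] by (rule integral_unique)
  ultimately have "(\<lambda>k. if k = j then c k * (pi * cos (\<gamma> - \<delta>)) else 0) sums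
      integral {a..a + 2*pi} (\<lambda>t. cos_series c \<gamma> t * cos (real j * t - \<delta>))"
    by (simp add: if_distrib[of "\<lambda>x. _ * x"] cong: if_cong)
  then show ?thesis using sums_single[of j "\<lambda>k. c k * (pi * cos (\<gamma> - \<delta>))"] by (simp add: sums_iff mult_ac)
qed

lemma cos_series_convolution:
  assumes c: "summable (\<lambda>k. \<bar>c k\<bar>)" and j: "j \<ge> 1"
  shows "integral {a..a + 2*pi} (\<lambda>t. cos_series c \<gamma> (x - t) * cos (real j * t)) = pi * c j * cos (real j * x - \<gamma>)"
proof -
  have "(\<lambda>k. c k * integral {a..a + 2*pi} (\<lambda>t. cos (real k * (x - t) - \<gamma>) * cos (real j * t))) sums
      integral {a..a + 2*pi} (\<lambda>t. cos_series c \<gamma> (x - t) * cos (real j * t))"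
    by (intro cos_series_integral_sums c continuous_intros)
  moreover have "integral {a..a + 2*pi} (\<lambda>t. cos (real k * (x - t) - \<gamma>) * cos (real j * t)) =
      (if k = j then pi * cos (real k * x - \<gamma>) else 0)" for k
  proof -
    have "cos (real k * (x - t) - \<gamma>) = cos (real k * t - (real k * x - \<gamma>))" for t
      using cos_minus[of "real k * (x - t) - \<gamma>"] by (simp add: algebra_simps)
    then show ?thesis using integral_cos_cos[OF j, of k "real k * x - \<gamma>" 0 a] by (simp add: integral_unique)
  qed
  ultimately have "(\<lambda>k. if k = j then c k * (pi * cos (real k * x - \<gamma>)) else 0) sums
      integral {a..a + 2*pi} (\<lambda>t. cos_series c \<gamma> (x - t) * cos (real j * t))"
    by (simp add: if_distrib[of "\<lambda>x. _ * x"] cong: if_cong)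
  then show ?thesis
    using sums_single[of j "\<lambda>k. c k * (pi * cos (real k * x - \<gamma>))"] by (simp add: sums_iff mult_ac)
qed

lemma cos_series_mean:
  assumes c: "summable (\<lambda>k. \<bar>c k\<bar>)" and "c 0 = 0"
  shows "integral {a..a + 2*pi} (cos_series c \<gamma>) = 0"
proof -
  have "(\<lambda>k. c k * integral {a..a + 2*pi} (\<lambda>t. cos (real k * t - \<gamma>) * 1)) sums
      integral {a..a + 2*pi} (\<lambda>t. cos_series c \<gamma> t * 1)"
    by (intro cos_series_integral_sums c continuous_intros)
  moreover have "c k * integral {a..a + 2*pi} (\<lambda>t. cos (real k * t - \<gamma>) * 1) = 0" for k
    using has_integral_cos_period[of "int k" "- \<gamma>" a] \<open>c 0 = 0\<close> by (cases "k = 0") (auto simp: integral_unique)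
  then have "(\<lambda>k. c k * integral {a..a + 2*pi} (\<lambda>t. cos (real k * t - \<gamma>) * 1)) = (\<lambda>k. 0)"
    by (intro ext)
  ultimately have "(\<lambda>k. 0) sums integral {a..a + 2*pi} (\<lambda>t. cos_series c \<gamma> t * 1)" by (simp only:)
  then show ?thesis using sums_unique2[OF sums_zero] by fastforce
qed

text \<open>Membership in the class says nothing about \<open>\<psi> 0\<close>, and the series
  starts at 1, so index 0 is set to zero explicitly.\<close>

definition psi_coeff :: "(real \<Rightarrow> real) \<Rightarrow> nat \<Rightarrow> real" where
  "psi_coeff \<psi> k = (if k = 0 then 0 else \<psi> (real k))"

lemma psi_coeff_summable:
  assumes P: "\<psi> \<in> classM_plus_inf" and b: "b > 2" "mu \<psi> (real n) \<ge> b" and n: "n \<ge> 1"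
  shows "summable (\<lambda>k. \<bar>psi_coeff \<psi> k\<bar>)"
proof -
  note M = classM_plus_inf_D(1)[OF P]
  have "summable (\<lambda>j. \<psi> (real n + real j))"
    using classM_D(1)[OF M] n psi_partial_sum_bound[OF P _ b]
    by (intro bounded_imp_summable[where B = "2 * b / (b - 2) * \<psi> n * (eta \<psi> n - n + 1)"])
       (auto intro: less_imp_le simp only: lessThan_Suc_atMost[symmetric])
  then have "summable (\<lambda>j. \<bar>psi_coeff \<psi> (j + n)\<bar>)"
    using classM_D(1)[OF M] n by (simp add: psi_coeff_def add.commute abs_of_pos)
  then show ?thesis using summable_iff_shift[of "\<lambda>k. \<bar>psi_coeff \<psi> k\<bar>" n] by blast
qed

lemma is_Psi_beta_cos_series:
  assumes c: "summable (\<lambda>k. \<bar>psi_coeff \<psi> k\<bar>)"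
  shows "is_Psi_beta \<psi> \<beta> (cos_series (psi_coeff \<psi>) (\<beta> * pi / 2))"
proof -
  let ?S = "cos_series (psi_coeff \<psi>) (\<beta> * pi / 2)"
  note cont = cos_series_continuous[OF c]
  have L: "(LINT t:{0..2*pi}|lebesgue. g t) = integral {0..0+2*pi} g" if "continuous_on {0..2*pi} g" for g :: "real \<Rightarrow> real"
    using set_lebesgue_integral_eq_integral(2)[OF absolutely_integrable_continuous_real[OF that]] by simp
  have "(1/pi) * (LINT t:{0..2*pi}|lebesgue. ?S t * cos (real k * t)) = \<psi> (real k) * cos (\<beta>*pi/2)" if "k \<ge> 1" for k
    using cos_series_coefficient[OF c that, of 0 "\<beta> * pi / 2" 0] that
    by (subst L) (auto intro!: continuous_intros cont simp: psi_coeff_def[of _ k])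
  moreover have "(1/pi) * (LINT t:{0..2*pi}|lebesgue. ?S t * sin (real k * t)) = \<psi> (real k) * sin (\<beta>*pi/2)" if "k \<ge> 1" for k
    using cos_series_coefficient[OF c that, of 0 "\<beta> * pi / 2" "pi/2"] that
    by (subst L) (auto intro!: continuous_intros cont simp: psi_coeff_def[of _ k] cos_diff)
  moreover have "(LINT t:{0..2*pi}|lebesgue. ?S t) = 0"
    using cos_series_mean[OF c, of 0] by (subst L) (auto intro!: cont simp: psi_coeff_def[of _ 0])
  moreover have "set_integrable lebesgue {0..2*pi} ?S"
    by (intro absolutely_integrable_continuous_real cont)
  ultimately show ?thesis by (auto simp: is_Psi_beta_def cos_series_periodic)
qed

text \<open>Members of the class may come from any kernel with the right coefficients. This reduces
  them to the continuous representative given by the cosine series.\<close>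

lemma is_Psi_beta_unique:
  assumes A: "is_Psi_beta \<psi> \<beta> \<Phi>" and B: "is_Psi_beta \<psi> \<beta> \<Psi>"
  shows "AE t in lebesgue. \<Phi> t = \<Psi> t"
proof (rule AE_lebesgue_periodic)
  show "(\<Phi> (t + 2*pi) = \<Psi> (t + 2*pi)) = (\<Phi> t = \<Psi> t)" for t
    using A B by (simp add: is_Psi_beta_def periodic2pi_def)
  have i: "set_integrable lebesgue {0..2*pi} \<Phi>" "set_integrable lebesgue {0..2*pi} \<Psi>"
    using A B by (auto simp: is_Psi_beta_def)
  have "(LINT t:{0..2*pi}|lebesgue. (\<Phi> t - \<Psi> t) * cos (real k * t)) = 0" for k :: nat
  proof (cases "k = 0")
    case True
    then show ?thesis using A B i by (simp add: is_Psi_beta_def)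
  next
    case False
    then have "(LINT t:{0..2*pi}|lebesgue. \<Phi> t * cos (real k * t)) = (LINT t:{0..2*pi}|lebesgue. \<Psi> t * cos (real k * t))"
    proof -
      have "(1/pi) * (LINT t:{0..2*pi}|lebesgue. \<Phi> t * cos (real k * t)) =
          (1/pi) * (LINT t:{0..2*pi}|lebesgue. \<Psi> t * cos (real k * t))"
        using A B False by (simp add: is_Psi_beta_def Suc_le_eq)
      then show ?thesis by simp
    qed
    then show ?thesis unfolding left_diff_distrib
      by (subst set_integral_diff) (auto intro!: set_integrable_mult_continuous i continuous_intros)
  qed
  moreover have "(LINT t:{0..2*pi}|lebesgue. (\<Phi> t - \<Psi> t) * sin (real k * t)) = 0" for k :: nat
  proof (cases "k = 0")
    case False
    then have "(LINT t:{0..2*pi}|lebesgue. \<Phi> t * sin (real k * t)) = (LINT t:{0..2*pi}|lebesgue. \<Psi> t * sin (real k * t))"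
    proof -
      have "(1/pi) * (LINT t:{0..2*pi}|lebesgue. \<Phi> t * sin (real k * t)) =
          (1/pi) * (LINT t:{0..2*pi}|lebesgue. \<Psi> t * sin (real k * t))"
        using A B False by (simp add: is_Psi_beta_def Suc_le_eq)
      then show ?thesis by simp
    qed
    then show ?thesis unfolding left_diff_distrib
      by (subst set_integral_diff) (auto intro!: set_integrable_mult_continuous i continuous_intros)
  qed simp
  ultimately have "AE t in lebesgue. t \<in> {0..2*pi} \<longrightarrow> \<Phi> t - \<Psi> t = 0"
    by (intro Fourier_uniqueness[OF set_integral_diff(1)[OF i]])
  then show "AE t in lebesgue. t \<in> {0..2*pi} \<longrightarrow> \<Phi> t = \<Psi> t" by simp
qed

section \<open>The lower bound\<close>

text \<open>The Fejer kernel as the squared modulus of \<open>\<Sum>p<R. cis (p * t)\<close>,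
  divided by \<open>R\<close> and multiplied out. The double sum is not collected by frequency, so
  every pair stays one cosine of weight 1 and the triangular weights turn into a count of
  pairs.\<close>

definition fejer :: "nat \<Rightarrow> real \<Rightarrow> real" where
  "fejer R t = (\<Sum>z\<in>{..<R} \<times> {..<R}. cos ((real (fst z) - real (snd z)) * t)) / real R"

lemma fejer_square:
  "fejer R t = ((\<Sum>p<R. cos (real p * t))^2 + (\<Sum>p<R. sin (real p * t))^2) / real R"
proof -
  have "(\<Sum>z\<in>{..<R} \<times> {..<R}. cos ((real (fst z) - real (snd z)) * t)) =
     (\<Sum>p<R. \<Sum>q<R. cos (real p * t) * cos (real q * t) + sin (real p * t) * sin (real q * t))"
    by (simp add: sum.cartesian_product case_prod_beta left_diff_distrib cos_diff)
  also have "\<dots> = (\<Sum>p<R. cos (real p * t))^2 + (\<Sum>p<R. sin (real p * t))^2"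
    by (simp add: power2_eq_square sum_product sum.distrib)
  finally show ?thesis by (simp add: fejer_def)
qed

lemma fejer_nonneg: "0 \<le> fejer R t"
  unfolding fejer_square by simp

lemma fejer_le: "fejer R t \<le> real R"
proof (cases "R = 0")
  case False
  have "(\<Sum>z\<in>{..<R} \<times> {..<R}. cos ((real (fst z) - real (snd z)) * t)) \<le> (\<Sum>z\<in>{..<R} \<times> {..<R}. 1)"
    by (intro sum_mono) auto
  then show ?thesis using False by (simp add: fejer_def pos_divide_le_eq)
qed (simp add: fejer_def)

lemma fejer_continuous: "continuous_on A (fejer R)"
  unfolding fejer_def by (cases "R = 0") (auto intro!: continuous_intros)

lemma fejer_has_integral:
  assumes "R > 0"
  shows "(fejer R has_integral 2 * pi) {0..2*pi}"
proof -
  have "((\<lambda>t. (\<Sum>z\<in>{..<R} \<times> {..<R}. cos (of_int (int (fst z) - int (snd z)) * t + 0)) / real R) has_integral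
     (\<Sum>z\<in>{..<R} \<times> {..<R}. if int (fst z) - int (snd z) = 0 then 2 * pi * cos 0 else 0) / real R) {0..0+2*pi}"
    by (intro has_integral_divide has_integral_sum has_integral_cos_period) auto
  moreover have "(\<Sum>z\<in>{..<R} \<times> {..<R}. if int (fst z) - int (snd z) = 0 then 2 * pi * cos 0 else 0) =
      (\<Sum>p<R. \<Sum>q<R. if q = p then 2 * pi else 0)"
    unfolding sum.cartesian_product case_prod_beta by (rule sum.cong) auto
  ultimately show ?thesis using assms by (simp add: fejer_def[abs_def])
qed

text \<open>The truncated subtraction is harmless, since \<open>snd z \<le> N\<close> in all uses.\<close>

definition freq :: "nat \<Rightarrow> nat \<times> nat \<Rightarrow> nat" where
  "freq N z = N + fst z - snd z"

text \<open>The sine part of the addition formula cancels because \<open>sin ((p - q) * t)\<close>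
  is antisymmetric in the pair.\<close>

lemma fejer_modulated:
  assumes "R \<le> N + 1"
  shows "fejer R t * cos (real N * t - \<delta>) =
    (\<Sum>z\<in>{..<R} \<times> {..<R}. cos (real (freq N z) * t - \<delta>)) / real R"
proof -
  let ?A = "{..<R} \<times> {..<R}"
  have z: "(\<Sum>z\<in>?A. sin ((real (fst z) - real (snd z)) * t)) = 0"
  proof -
    have "(\<Sum>z\<in>?A. sin ((real (fst z) - real (snd z)) * t)) =
       (\<Sum>p<R. \<Sum>q<R. sin (real p * t) * cos (real q * t)) - (\<Sum>p<R. \<Sum>q<R. cos (real p * t) * sin (real q * t))"
      by (simp add: sum.cartesian_product case_prod_beta left_diff_distrib sin_diff sum_subtractf)
    then show ?thesis by (simp flip: sum_product)
  qed
  have "cos (real (freq N z) * t - \<delta>) = cos ((real (fst z) - real (snd z)) * t) * cos (real N * t - \<delta>)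
      - sin ((real (fst z) - real (snd z)) * t) * sin (real N * t - \<delta>)" if "z \<in> ?A" for z
  proof -
    have "snd z \<le> N" using that assms by auto
    then have "real (freq N z) * t - \<delta> = (real (fst z) - real (snd z)) * t + (real N * t - \<delta>)"
      by (simp add: freq_def of_nat_diff algebra_simps)
    then show ?thesis by (simp only: cos_add)
  qed
  then have "(\<Sum>z\<in>?A. cos (real (freq N z) * t - \<delta>)) =
      (\<Sum>z\<in>?A. cos ((real (fst z) - real (snd z)) * t)) * cos (real N * t - \<delta>)
      - (\<Sum>z\<in>?A. sin ((real (fst z) - real (snd z)) * t)) * sin (real N * t - \<delta>)"
    by (simp add: sum_distrib_right sum_subtractf)
  then show ?thesis unfolding z by (simp add: fejer_def)
qed

text \<open>The sum counts coincidences \<open>p - q = p' - q'\<close> and is thus of the order of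
  the additive energy of an interval. Translating a pair \<open>(p, q)\<close> by \<open>r\<close>
  produces a coincidence; with all three numbers below \<open>H\<close>, half of \<open>R\<close>
  rounded up, the translates still lie below \<open>R\<close>.\<close>

lemma freq_collisions:
  "real R ^ 3 / 8 \<le> (\<Sum>z\<in>{..<R} \<times> {..<R}. \<Sum>w\<in>{..<R} \<times> {..<R}. if freq N z = freq N w then 1 else 0 :: real)"
proof -
  let ?A = "{..<R} \<times> {..<R}"
  define H where "H = (R + 1) div 2"
  define inj where "inj = (\<lambda>(p::nat, q::nat, r::nat). ((p, q), (p + r, q + r)))"
  let ?B = "{..<H} \<times> {..<H} \<times> {..<H}"
  have "inj_on inj ?B" by (auto simp: inj_on_def inj_def)
  then have "card (inj ` ?B) = H ^ 3" by (simp add: card_image card_cartesian_product power3_eq_cube)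
  moreover have "card (inj ` ?B) \<le> card {v \<in> ?A \<times> ?A. freq N (fst v) = freq N (snd v)}"
    by (intro card_mono) (auto simp: inj_def H_def freq_def)
  ultimately have 1: "H ^ 3 \<le> card {v \<in> ?A \<times> ?A. freq N (fst v) = freq N (snd v)}" by simp
  have "(\<Sum>z\<in>?A. \<Sum>w\<in>?A. if freq N z = freq N w then 1 else 0 :: real) =
      (\<Sum>v\<in>?A \<times> ?A. if freq N (fst v) = freq N (snd v) then 1 else 0)"
    by (simp add: sum.cartesian_product[where A = ?A] case_prod_beta)
  also have "\<dots> = (\<Sum>v\<in>{v \<in> ?A \<times> ?A. freq N (fst v) = freq N (snd v)}. 1)"
    by (rule sum.mono_neutral_cong_right) auto
  finally have 2: "(\<Sum>z\<in>?A. \<Sum>w\<in>?A. if freq N z = freq N w then 1 else 0 :: real) =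
      real (card {v \<in> ?A \<times> ?A. freq N (fst v) = freq N (snd v)})" by simp
  have "real R / 2 \<le> real H" unfolding H_def by linarith
  then have "(real R / 2) ^ 3 \<le> real H ^ 3" by (intro power_mono) auto
  also have "\<dots> \<le> real (card {v \<in> ?A \<times> ?A. freq N (fst v) = freq N (snd v)})"
    using 1 of_nat_le_iff[where 'a = real, of "H ^ 3"] by simp
  finally show ?thesis unfolding 2 by (simp add: power_divide)
qed

text \<open>Young's inequality for \<open>x / l\<close> against 1. The free scale \<open>l\<close>
  permits tuning close to the case of equality; \<open>r = 1\<close> is separate because its
  conjugate exponent is infinite.\<close>

lemma Young_scaled:
  fixes x l r :: real
  assumes "0 \<le> x" "0 < l" "1 \<le> r"
  shows "x \<le> l * (x powr r * l powr (- r) / r + (1 - 1 / r))"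
proof (cases "r = 1")
  case True
  then show ?thesis using assms by (simp add: powr_minus field_simps)
next
  case False
  then have r: "r > 1" using assms by simp
  have q: "r / (r - 1) > 1" "1 / r + 1 / (r / (r - 1)) = 1" using r by (auto simp: field_simps)
  have "x / l * 1 \<le> (x / l) powr r / r + 1 powr (r / (r - 1)) / (r / (r - 1))"
    using assms by (intro Youngs_inequality r q) auto
  also have "1 powr (r / (r - 1)) / (r / (r - 1)) = 1 - 1 / r" using r by (simp add: diff_divide_distrib)
  also have "(x / l) powr r = x powr r * l powr (- r)"
    using assms by (simp add: powr_divide powr_minus_divide)
  finally have "x / l \<le> x powr r * l powr (- r) / r + (1 - 1 / r)" by simp
  then show ?thesis using assms by (simp add: pos_divide_le_eq mult.commute)
qed

lemma LINT_continuous: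
  fixes g :: "real \<Rightarrow> real"
  assumes "continuous_on {a..b} g"
  shows "set_integrable lebesgue {a..b} g" "(LINT t:{a..b}|lebesgue. g t) = integral {a..b} g"
  using absolutely_integrable_continuous_real[OF assms] set_lebesgue_integral_eq_integral(2) by blast+

lemma continuous_borel_lebesgue:
  fixes h :: "real \<Rightarrow> real"
  assumes "continuous_on UNIV h"
  shows "h \<in> borel_measurable lebesgue"
  using assms by (intro measurable_completion) (simp add: borel_measurable_continuous_onI)

text \<open>Young's inequality at the scale \<open>l = I / (2 * pi)\<close> takes the place of Hoelder's inequality.\<close>

lemma Lnorm_lower_bound:
  fixes h g :: "real \<Rightarrow> real"
  assumes h: "continuous_on UNIV h" and g: "continuous_on {0..2*pi} g"
    and R: "R > 0" "\<And>t. \<bar>g t\<bar> \<le> R" and g1: "integral {0..2*pi} (\<lambda>t. \<bar>g t\<bar>) \<le> 2 * pi"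
    and I: "I > 0" "I \<le> integral {0..2*pi} (\<lambda>t. h t * g t)" and s: "1 \<le> s"
  shows "ereal (I / ((2*pi) powr conj_inv s * R powr (1 - conj_inv s))) \<le> Lnorm s h"
proof (cases "s = \<infinity>")
  case True
  have h': "continuous_on {0..2*pi} h" using h by (rule continuous_on_subset) simp
  let ?M = "restrict_space lebesgue {0..2*pi}"
  show ?thesis
  proof (rule ccontr)
    assume "\<not> ?thesis"
    then have less: "esssup ?M (\<lambda>x. ereal \<bar>h x\<bar>) < ereal (I / (2*pi))"
      using True R by (simp add: Lnorm_def conj_inv_def not_le)
    then obtain y where y: "esssup ?M (\<lambda>x. ereal \<bar>h x\<bar>) < ereal y" "y < I / (2*pi)"
      using ereal_dense2[OF less] by auto
    have "AE x in ?M. ereal \<bar>h x\<bar> \<le> esssup ?M (\<lambda>x. ereal \<bar>h x\<bar>)" by (rule esssup_AE)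
    \<comment> \<open>The number \<open>y\<close> comes from density alone and might be negative;
      the maximum makes it usable as a nonnegative factor.\<close>
    then have "AE x in ?M. \<bar>h x\<bar> \<le> max 0 y"
      by eventually_elim (use y in \<open>metis dual_order.trans ereal_less_eq(3) less_imp_le max.coboundedI2\<close>)
    then have "AE x in lebesgue. x \<in> {0..2*pi} \<longrightarrow> \<bar>h x\<bar> \<le> max 0 y"
      by (simp add: AE_restrict_space_iff)
    then have ae: "AE x in lebesgue. x \<in> {0..2*pi} \<longrightarrow> h x * g x \<le> max 0 y * \<bar>g x\<bar>"
    proof eventually_elim
      case (elim x)
      have "h x * g x \<le> \<bar>h x\<bar> * \<bar>g x\<bar>" by (metis abs_ge_self abs_mult)
      then show ?case using elim mult_right_mono[of "\<bar>h x\<bar>" "max 0 y" "\<bar>g x\<bar>"] by auto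
    qed
    have "I \<le> (LINT t:{0..2*pi}|lebesgue. h t * g t)"
      using I(2) LINT_continuous(2)[OF continuous_on_mult[OF h' g]] by simp
    also have "\<dots> \<le> (LINT t:{0..2*pi}|lebesgue. max 0 y * \<bar>g t\<bar>)"
      using ae by (intro set_integral_mono_AE LINT_continuous continuous_intros g h')
                  (auto elim: eventually_mono)
    also have "\<dots> = max 0 y * integral {0..2*pi} (\<lambda>t. \<bar>g t\<bar>)"
      by (subst LINT_continuous) (auto intro!: continuous_intros g)
    also have "\<dots> \<le> max 0 y * (2*pi)" using g1 by (intro mult_left_mono) auto
    also have "\<dots> < I" using y(2) I(1) by (auto simp: max_def field_simps)
    finally show False by simp
  qed
next
  case False
  define r where "r = real_of_ereal s"
  have s_r: "s = ereal r" using False s by (cases s) (auto simp: r_def)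
  have r: "r \<ge> 1" using s by (simp add: s_r)
  have \<sigma>: "conj_inv s = 1 - 1 / r" by (simp add: s_r conj_inv_def)
  have h': "continuous_on {0..2*pi} h" using h by (rule continuous_on_subset) simp
  have hr: "continuous_on {0..2*pi} (\<lambda>x. \<bar>h x\<bar> powr r)"
    by (rule continuous_on_powr') (use r in \<open>auto intro!: continuous_intros h'\<close>)
  define J where "J = integral {0..2*pi} (\<lambda>x. \<bar>h x\<bar> powr r)"
  have norm_eq: "Lnorm s h = ereal (J powr (1 / r))"
    using LINT_continuous[OF hr] continuous_borel_lebesgue[OF h] by (simp add: Lnorm_def s_r J_def)
  have J0: "J \<ge> 0" unfolding J_def by (intro integral_nonneg integrable_continuous_real hr) auto
  define u where "u t = \<bar>h t\<bar> powr r" for t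
  have u: "continuous_on {0..2*pi} u" "\<And>t. u t \<ge> 0" using hr by (auto simp: u_def[abs_def])
  have J_eq: "J = integral {0..2*pi} u" by (simp add: J_def u_def[abs_def])
  define l where "l = I / (2*pi)"
  have l: "l > 0" using I by (simp add: l_def)
  have "I \<le> integral {0..2*pi} (\<lambda>t. h t * g t)" by (fact I)
  \<comment> \<open>The weight \<open>\<bar>g t\<bar>\<close> is replaced by its bound
    \<open>R\<close> only next to \<open>u\<close>; in the other term its integral is used. This
    mixture gives the interpolated dual norm
    \<open>(2*pi) powr (1 - 1/r) * R powr (1/r)\<close>.\<close>
  also have "\<dots> \<le> integral {0..2*pi} (\<lambda>t. l * (R * (u t * l powr (- r) / r) + (1 - 1 / r) * \<bar>g t\<bar>))"
  proof (intro integral_le integrable_continuous_real continuous_intros h' g u(1))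
    fix t
    have "h t * g t \<le> \<bar>h t\<bar> * \<bar>g t\<bar>" by (metis abs_ge_self abs_mult)
    also have "\<dots> \<le> l * (u t * l powr (- r) / r + (1 - 1 / r)) * \<bar>g t\<bar>"
      unfolding u_def using r l by (intro mult_right_mono Young_scaled) auto
    also have "\<dots> = l * (\<bar>g t\<bar> * (u t * l powr (- r) / r) + (1 - 1 / r) * \<bar>g t\<bar>)"
      by (simp add: algebra_simps)
    also have "\<dots> \<le> l * (R * (u t * l powr (- r) / r) + (1 - 1 / r) * \<bar>g t\<bar>)"
      using R(2)[of t] r l u(2)[of t] by (intro mult_left_mono add_right_mono mult_right_mono) auto
    finally show "h t * g t \<le> l * (R * (u t * l powr (- r) / r) + (1 - 1 / r) * \<bar>g t\<bar>)" .
  qed (use r in auto)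
  also have "\<dots> = l * (R * (J * l powr (- r) / r) + (1 - 1 / r) * integral {0..2*pi} (\<lambda>t. \<bar>g t\<bar>))"
  proof (rule integral_unique)
    have "(u has_integral J) {0..2*pi}"
      unfolding J_eq by (intro integrable_integral integrable_continuous_real u(1))
    moreover have "((\<lambda>x. \<bar>g x\<bar>) has_integral integral {0..2*pi} (\<lambda>t. \<bar>g t\<bar>)) {0..2*pi}"
      by (intro integrable_integral integrable_continuous_real continuous_intros g)
    ultimately show "((\<lambda>t. l * (R * (u t * l powr (- r) / r) + (1 - 1 / r) * \<bar>g t\<bar>)) has_integral
        l * (R * (J * l powr (- r) / r) + (1 - 1 / r) * integral {0..2*pi} (\<lambda>t. \<bar>g t\<bar>))) {0..2*pi}"
      by (intro has_integral_mult_right has_integral_add has_integral_divide has_integral_mult_left)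
  qed
  also have "\<dots> \<le> l * (R * (J * l powr (- r) / r) + (1 - 1 / r) * (2*pi))"
    using g1 r l by (intro mult_left_mono add_left_mono) auto
  also have "\<dots> = l * R * J * l powr (- r) / r + I - I / r"
    by (simp add: l_def field_simps)
  \<comment> \<open>For \<open>l = I / (2*pi)\<close> the constant term equals
    \<open>I - I / r\<close>, so exactly \<open>I / r\<close> of the left side survives.\<close>
  finally have "I / r \<le> l * R * J * l powr (- r) / r" by simp
  then have "I \<le> l * R * J * l powr (- r)" using r by (simp add: divide_le_cancel)
  also have "\<dots> = R * J * l / l powr r" by (simp add: powr_minus_divide)
  finally have "I * l powr r \<le> R * J * l" using l by (simp add: pos_le_divide_eq)
  then have "(2 * pi * l powr r) * l \<le> (R * J) * l" by (simp add: l_def mult_ac)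
  then have "2 * pi * l powr r \<le> R * J" using l by (simp only: mult_le_cancel_right_pos)
  then have "(2 * pi / R) * l powr r \<le> J" using R by (simp add: field_simps)
  then have "((2 * pi / R) * l powr r) powr (1 / r) \<le> J powr (1 / r)"
    using R r by (intro powr_mono2) auto
  moreover have "((2 * pi / R) * l powr r) powr (1 / r) = I / ((2*pi) powr (1 - 1 / r) * R powr (1 / r))"
  proof -
    have "((2 * pi / R) * l powr r) powr (1 / r) = ((2 * pi) powr (1 / r) / R powr (1/r)) * l"
      using R l r by (simp add: powr_mult powr_divide powr_powr)
    also have "\<dots> = I * ((2 * pi) powr (1 / r) / (2 * pi) powr 1) / R powr (1/r)"
      by (simp add: l_def mult_ac)
    also have "(2 * pi) powr (1 / r) / (2 * pi) powr 1 = 1 / (2*pi) powr (1 - 1 / r)"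
      by (simp only: powr_diff[symmetric] powr_minus_divide[symmetric]) simp
    finally show ?thesis by simp
  qed
  ultimately show ?thesis by (simp add: norm_eq \<sigma>)
qed

section \<open>Orthogonality to low degrees and the function realising the lower bound\<close>

lemma trig_poly_continuous: "T \<in> trig_polys n \<Longrightarrow> continuous_on A T"
  unfolding trig_polys_def by (auto intro!: continuous_intros)

lemma trig_poly_cos_orthogonal:
  assumes T: "T \<in> trig_polys n" and j: "n \<le> j" "1 \<le> j"
  shows "((\<lambda>t. T t * cos (real j * t - \<gamma>)) has_integral 0) {0..2*pi}"
proof -
  obtain a b where T_eq: "T = (\<lambda>x. \<Sum>k<n. a k * cos (real k * x) + b k * sin (real k * x))"
    using T by (auto simp: trig_polys_def)
  have c: "((\<lambda>t. cos (real k * t) * cos (real j * t - \<gamma>)) has_integral 0) {0..2*pi}"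
   and s: "((\<lambda>t. sin (real k * t) * cos (real j * t - \<gamma>)) has_integral 0) {0..2*pi}" if "k < n" for k
    using integral_cos_cos[OF j(2), of k 0 \<gamma> 0] integral_cos_cos[OF j(2), of k "pi/2" \<gamma> 0] that j
    by (simp_all add: cos_diff[of _ "pi/2"])
  have "((\<lambda>t. \<Sum>k<n. a k * (cos (real k * t) * cos (real j * t - \<gamma>)) + b k * (sin (real k * t) * cos (real j * t - \<gamma>)))
      has_integral (\<Sum>k<n. a k * 0 + b k * 0)) {0..2*pi}"
    by (intro has_integral_sum has_integral_add has_integral_mult_right c s) auto
  then show ?thesis unfolding T_eq by (simp add: sum_distrib_right distrib_right mult.assoc)
qed

lemma best_approx_lower:
  assumes P: "\<psi> \<in> classM_plus_inf" and b: "b > 2" "mu \<psi> (real n) \<ge> b" and n: "n \<ge> 1"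
    and m: "eta \<psi> (real n) - real n > 2" and s: "1 \<le> s"
  shows "ereal (\<psi> (real n) * (eta \<psi> (real n) - real n) powr conj_inv s / (128 * pi))
    \<le> best_approx n (Lclass \<psi> \<beta> 1) s"
proof -
  note M = classM_plus_inf_D(1)[OF P]
  define m where "m = eta \<psi> (real n) - real n"
  \<comment> \<open>The largest \<open>R\<close> with \<open>2 * (R - 1) \<le> m\<close>. Around the
    centre \<open>N = n + R - 1\<close> the frequencies run from \<open>n\<close> to
    \<open>n + 2 * (R - 1) \<le> eta \<psi> n\<close>, so every coefficient involved is at least
    \<open>\<psi> n / 2\<close>.\<close>
  define R where "R = nat \<lfloor>m / 2\<rfloor> + 1"
  define N where "N = n + R - 1"
  define \<gamma> where "\<gamma> = \<beta> * pi / 2"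
  define c where "c = psi_coeff \<psi>"
  define A where "A = {..<R} \<times> {..<R}"
  have m2: "m > 2" using m by (simp add: m_def)
  have R: "R > 0" "real R \<ge> m / 2" "2 * (real R - 1) \<le> m"
    using m2 unfolding R_def by (auto, linarith+)
  have RN: "R \<le> N + 1" "N \<ge> 1" using n R(1) by (auto simp: N_def)
  have finA: "finite A" by (simp add: A_def)
  have c_sum: "summable (\<lambda>k. \<bar>c k\<bar>)" unfolding c_def by (rule psi_coeff_summable[OF P b n])
  have fr: "n \<le> freq N z" "1 \<le> freq N z" "c (freq N z) \<ge> \<psi> n / 2" if "z \<in> A" for z
  proof -
    have z: "fst z < R" "snd z < R" using that by (auto simp: A_def)
    then show ge: "n \<le> freq N z" by (auto simp: freq_def N_def)
    then show 1: "1 \<le> freq N z" using n by simp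
    have "freq N z \<le> n + 2 * (R - 1)" using z by (auto simp: freq_def N_def)
    then have "real (freq N z) \<le> real (n + 2 * (R - 1))" by (simp only: of_nat_le_iff)
    also have "\<dots> = real n + 2 * (real R - 1)" using R(1) by (simp add: of_nat_diff)
    finally have "real (freq N z) \<le> real n + 2 * (real R - 1)" .
    then have "real (freq N z) \<le> eta \<psi> n" using R(3) by (simp add: m_def)
    then have "\<psi> (eta \<psi> n) \<le> \<psi> (freq N z)" using 1 by (intro classM_antimono[OF M]) auto
    then show "c (freq N z) \<ge> \<psi> n / 2" using psi_eta[OF M, of n] n 1 by (simp add: c_def psi_coeff_def)
  qed
  define \<Psi> where "\<Psi> = cos_series c \<gamma>"
  have \<Psi>: "is_Psi_beta \<psi> \<beta> \<Psi>" using is_Psi_beta_cos_series[of \<psi> \<beta>] c_sum by (simp add: \<Psi>_def c_def \<gamma>_def)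
  \<comment> \<open>The Fejer kernel is nonnegative with integral \<open>2 * pi\<close>, which
    bounds the norm of \<phi> by 1, and the modulation moves all frequencies away from 0, which
    makes its mean vanish.\<close>
  define \<phi> where "\<phi> t = fejer R t * cos (real N * t) / (2*pi)" for t
  have \<phi>_eq: "\<phi> t = (\<Sum>z\<in>A. cos (real (freq N z) * t)) / (2 * pi * real R)" for t
    using fejer_modulated[OF RN(1), of t 0] by (simp add: \<phi>_def A_def)
  have \<phi>_cont: "continuous_on S \<phi>" for S
    unfolding \<phi>_def by (intro continuous_intros fejer_continuous) auto
  have per_cos: "cos (real k * (t + 2*pi)) = cos (real k * t)" for k t
  proof -
    have "real k * (t + 2*pi) = real k * t + 2 * pi * of_int (int k)" by (simp add: algebra_simps)
    then show ?thesis using cos_add[of "real k * t" "2 * pi * of_int (int k)"]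
      by (simp only: sin_int_2pin cos_int_2pin)
  qed
  have \<phi>_B0: "\<phi> \<in> B0 1"
  proof -
    have "periodic2pi \<phi>" unfolding periodic2pi_def \<phi>_eq per_cos by simp
    moreover have "(\<phi> has_integral (\<Sum>z\<in>A. 0) / (2 * pi * real R)) {0..2*pi}"
      unfolding \<phi>_eq[abs_def]
    proof (intro has_integral_divide has_integral_sum finA)
      fix z assume "z \<in> A"
      with fr(2)[of z] show "((\<lambda>t. cos (real (freq N z) * t)) has_integral 0) {0..2*pi}"
        using has_integral_cos_period[of "int (freq N z)" 0 0] by simp
    qed
    then have "(LINT t:{0..2*pi}|lebesgue. \<phi> t) = 0"
      by (subst LINT_continuous(2)[OF \<phi>_cont]) (simp add: integral_unique)
    moreover have "Lnorm 1 \<phi> \<le> 1"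
    proof -
      have "integral {0..2*pi} (\<lambda>t. \<bar>\<phi> t\<bar>) \<le> integral {0..2*pi} (\<lambda>t. fejer R t / (2*pi))"
      proof (intro integral_le integrable_continuous_real continuous_intros \<phi>_cont fejer_continuous)
        fix t
        show "\<bar>\<phi> t\<bar> \<le> fejer R t / (2*pi)"
          using fejer_nonneg[of R t] by (simp add: \<phi>_def abs_mult divide_right_mono mult_left_le)
      qed auto
      also have "\<dots> = 2 * pi / (2 * pi)"
        by (intro integral_unique has_integral_divide fejer_has_integral R)
      finally have "integral {0..2*pi} (\<lambda>t. \<bar>\<phi> t\<bar>) \<le> 1" by simp
      moreover have ca: "continuous_on {0..2*pi} (\<lambda>t. \<bar>\<phi> t\<bar>)" by (intro continuous_intros \<phi>_cont)
      moreover have "integral {0..2*pi} (\<lambda>t. \<bar>\<phi> t\<bar>) \<ge> 0"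
        by (intro integral_nonneg integrable_continuous_real ca) auto
      ultimately show ?thesis
        using LINT_continuous[OF ca] continuous_borel_lebesgue[OF \<phi>_cont]
        by (simp add: Lnorm_def one_ereal_def)
    qed
    ultimately show ?thesis
      using LINT_continuous(1)[OF \<phi>_cont] continuous_borel_lebesgue[OF \<phi>_cont] by (simp add: B0_def)
  qed
  define f where "f x = (1/pi) * (LINT t:{-pi..pi}|lebesgue. \<Psi> (x - t) * \<phi> t)" for x
  have \<Psi>_cont: "continuous_on S \<Psi>" for S unfolding \<Psi>_def by (rule cos_series_continuous[OF c_sum])
  have f_eq: "f x = (\<Sum>z\<in>A. c (freq N z) * cos (real (freq N z) * x - \<gamma>)) / (2 * pi * real R)" for x
  proof -
    have cont: "continuous_on S (\<lambda>t. \<Psi> (x - t))" for S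
      by (rule continuous_on_compose2[OF \<Psi>_cont[of UNIV]]) (auto intro!: continuous_intros)
    have conv: "((\<lambda>t. \<Psi> (x - t) * cos (real j * t)) has_integral pi * c j * cos (real j * x - \<gamma>)) {-pi..pi}"
      if "j \<ge> 1" for j
    proof -
      have "(\<lambda>t. \<Psi> (x - t) * cos (real j * t)) integrable_on {-pi..pi}"
        by (intro integrable_continuous_real continuous_intros cont)
      then show ?thesis
        using cos_series_convolution[OF c_sum that, of "-pi" \<gamma> x]
        by (simp add: has_integral_iff \<Psi>_def)
    qed
    have "((\<lambda>t. (\<Sum>z\<in>A. \<Psi> (x - t) * cos (real (freq N z) * t)) / (2 * pi * real R)) has_integral
        (\<Sum>z\<in>A. pi * c (freq N z) * cos (real (freq N z) * x - \<gamma>)) / (2 * pi * real R)) {-pi..pi}"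
      by (intro has_integral_divide has_integral_sum finA conv fr)
    then have "((\<lambda>t. \<Psi> (x - t) * \<phi> t) has_integral
        (\<Sum>z\<in>A. pi * c (freq N z) * cos (real (freq N z) * x - \<gamma>)) / (2 * pi * real R)) {-pi..pi}"
      by (simp add: \<phi>_eq sum_distrib_left)
    then have "(LINT t:{-pi..pi}|lebesgue. \<Psi> (x - t) * \<phi> t) =
        (\<Sum>z\<in>A. pi * c (freq N z) * cos (real (freq N z) * x - \<gamma>)) / (2 * pi * real R)"
      by (subst LINT_continuous) (auto intro!: continuous_intros cont \<phi>_cont simp: integral_unique)
    also have "\<dots> = pi * ((\<Sum>z\<in>A. c (freq N z) * cos (real (freq N z) * x - \<gamma>)) / (2 * pi * real R))"
      by (simp add: sum_distrib_left mult.assoc)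
    finally show ?thesis by (simp add: f_def)
  qed
  have f_class: "f \<in> Lclass \<psi> \<beta> 1"
  proof -
    have "\<Psi> (x + 2 * pi - t) = \<Psi> (x - t)" for x t
      using \<Psi> unfolding is_Psi_beta_def periodic2pi_def by (metis add_diff_eq diff_add_eq)
    then have "periodic2pi f" by (simp add: periodic2pi_def f_def)
    moreover have "AE x in lebesgue. f x = 0 / 2 + (1/pi) * (LINT t:{-pi..pi}|lebesgue. \<Psi> (x - t) * \<phi> t)"
      by (simp add: f_def)
    ultimately show ?thesis unfolding Lclass_def using \<Psi> \<phi>_B0 by blast
  qed
  have f_cont: "continuous_on S f" for S unfolding f_eq[abs_def]
    using R by (intro continuous_intros) auto
  \<comment> \<open>The phase \<gamma> is that of the terms of \<open>f\<close>, so each pair of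
    coinciding frequencies contributes with factor \<open>cos (\<gamma> - \<gamma>) = 1\<close> and
    nothing cancels.\<close>
  define g where "g t = fejer R t * cos (real N * t - \<gamma>)" for t
  have g_eq: "g t = (\<Sum>z\<in>A. cos (real (freq N z) * t - \<gamma>)) / real R" for t
    using fejer_modulated[OF RN(1), of t \<gamma>] by (simp add: g_def A_def)
  have g_cont: "continuous_on S g" for S unfolding g_def by (intro continuous_intros fejer_continuous)
  have g_le_fejer: "\<bar>g t\<bar> \<le> fejer R t" for t
    using fejer_nonneg[of R t] by (simp add: g_def abs_mult mult_left_le)
  have g_le: "\<bar>g t\<bar> \<le> real R" for t using g_le_fejer[of t] fejer_le[of R t] by linarith
  have g1: "integral {0..2*pi} (\<lambda>t. \<bar>g t\<bar>) \<le> 2*pi"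
  proof -
    have "integral {0..2*pi} (\<lambda>t. \<bar>g t\<bar>) \<le> integral {0..2*pi} (fejer R)"
      by (intro integral_le integrable_continuous_real continuous_intros g_cont fejer_continuous g_le_fejer)
    then show ?thesis using fejer_has_integral[OF R(1)] by (simp add: integral_unique)
  qed
  have psi_pos: "\<psi> n > 0" using classM_D(1)[OF M] n by simp
  \<comment> \<open>At least \<open>R^3 / 8\<close> coincidences, each worth at least
    \<open>pi * \<psi> n / 2\<close>, divided by the normalisation
    \<open>2 * pi * R^2\<close>.\<close>
  define I where "I = \<psi> n * real R / 32"
  have I0: "I > 0" using psi_pos R by (simp add: I_def)
  have fg: "((\<lambda>t. f t * g t) has_integral
      (\<Sum>z\<in>A. \<Sum>w\<in>A. if freq N z = freq N w then c (freq N z) * pi else 0) / (2 * pi * real R * real R)) {0..2*pi}"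
  proof -
    have "((\<lambda>t. (\<Sum>z\<in>A. \<Sum>w\<in>A. c (freq N z) * (cos (real (freq N z) * t - \<gamma>) * cos (real (freq N w) * t - \<gamma>)))
        / (2 * pi * real R * real R)) has_integral
      (\<Sum>z\<in>A. \<Sum>w\<in>A. c (freq N z) * (if freq N z = freq N w then pi * cos (\<gamma> - \<gamma>) else 0)) / (2 * pi * real R * real R)) {0..0+2*pi}"
      by (intro has_integral_divide has_integral_sum finA has_integral_mult_right integral_cos_cos fr)
    moreover have "f t * g t = (\<Sum>z\<in>A. \<Sum>w\<in>A. c (freq N z) * (cos (real (freq N z) * t - \<gamma>) * cos (real (freq N w) * t - \<gamma>)))
        / (2 * pi * real R * real R)" for t
      by (simp only: f_eq g_eq times_divide_times_eq sum_product mult.assoc)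
    ultimately show ?thesis by (simp add: if_distrib[of "\<lambda>x. _ * x"] cong: if_cong)
  qed
  have I_le: "I \<le> (\<Sum>z\<in>A. \<Sum>w\<in>A. if freq N z = freq N w then c (freq N z) * pi else 0) / (2 * pi * real R * real R)"
  proof -
    have "\<psi> n / 2 * pi * (real R ^ 3 / 8) \<le>
        \<psi> n / 2 * pi * (\<Sum>z\<in>A. \<Sum>w\<in>A. if freq N z = freq N w then 1 else 0)"
      using psi_pos freq_collisions[of R N] unfolding A_def by (intro mult_left_mono) auto
    also have "\<dots> = (\<Sum>z\<in>A. \<Sum>w\<in>A. if freq N z = freq N w then \<psi> n / 2 * pi else 0)"
      unfolding sum_distrib_left by (intro sum.cong) auto
    also have "\<dots> \<le> (\<Sum>z\<in>A. \<Sum>w\<in>A. if freq N z = freq N w then c (freq N z) * pi else 0)"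
      using fr(3) by (intro sum_mono) (auto intro: mult_right_mono)
    finally have "\<psi> n / 2 * pi * (real R ^ 3 / 8) / (2 * pi * real R * real R) \<le> 
       (\<Sum>z\<in>A. \<Sum>w\<in>A. if freq N z = freq N w then c (freq N z) * pi else 0) / (2 * pi * real R * real R)"
      by (intro divide_right_mono) auto
    moreover have "\<psi> n / 2 * pi * (real R ^ 3 / 8) / (2 * pi * real R * real R) = I"
      using R by (simp add: I_def field_simps power3_eq_cube)
    ultimately show ?thesis by simp
  qed
  have bound: "ereal (I / ((2*pi) powr conj_inv s * real R powr (1 - conj_inv s))) \<le> Lnorm s (\<lambda>x. f x - T x)"
    if T: "T \<in> trig_polys n" for T
  proof (rule Lnorm_lower_bound[OF _ g_cont _ g_le g1 I0 _ s])
    show "continuous_on UNIV (\<lambda>x. f x - T x)" by (intro continuous_intros f_cont trig_poly_continuous[OF T])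
    show "real R > 0" using R by simp
    have "((\<lambda>t. (\<Sum>z\<in>A. T t * cos (real (freq N z) * t - \<gamma>)) / real R) has_integral (\<Sum>z\<in>A. 0) / real R) {0..2*pi}"
      by (intro has_integral_divide has_integral_sum finA trig_poly_cos_orthogonal[OF T] fr)
    then have "((\<lambda>t. T t * g t) has_integral 0) {0..2*pi}" by (simp add: g_eq sum_distrib_left)
    from has_integral_diff[OF fg this] I_le
    show "I \<le> integral {0..2*pi} (\<lambda>t. (f t - T t) * g t)" by (simp add: left_diff_distrib integral_unique)
  qed
  define \<sigma> where "\<sigma> = conj_inv s"
  have \<sigma>: "0 \<le> \<sigma>" "\<sigma> \<le> 1" using s by (cases s; auto simp: \<sigma>_def conj_inv_def)+
  have "\<psi> n * m powr \<sigma> / (128 * pi) \<le> I / ((2*pi) powr \<sigma> * real R powr (1 - \<sigma>))"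
  proof -
    have "I / ((2*pi) powr \<sigma> * real R powr (1 - \<sigma>)) = \<psi> n / 32 * (real R / (2*pi)) powr \<sigma>"
      using R by (simp add: I_def powr_diff powr_divide)
    \<comment> \<open>\<open>R \<ge> m / 2\<close> gives \<open>(m / (4*pi)) powr \<sigma>\<close>,
      and \<sigma> \<le> 1 allows a full factor \<open>4 * pi\<close> for every exponent. Together
      with 32 this is the constant \<open>128 * pi\<close>.\<close>
    moreover have "m powr \<sigma> / (4*pi) \<le> (real R / (2*pi)) powr \<sigma>"
    proof -
      have "(4*pi) powr \<sigma> \<le> (4*pi) powr 1" using \<sigma> pi_gt3 by (intro powr_mono) auto
      then have "m powr \<sigma> / (4*pi) \<le> m powr \<sigma> / (4*pi) powr \<sigma>" by (intro divide_left_mono) auto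
      also have "\<dots> = (m / (4*pi)) powr \<sigma>" using m2 by (simp add: powr_divide)
      also have "\<dots> \<le> (real R / (2*pi)) powr \<sigma>"
        using R m2 \<sigma> by (intro powr_mono2) (auto simp: field_simps)
      finally show ?thesis .
    qed
    then have "\<psi> n / 32 * (m powr \<sigma> / (4*pi)) \<le> \<psi> n / 32 * (real R / (2*pi)) powr \<sigma>"
      using psi_pos by (intro mult_left_mono) auto
    moreover have "\<psi> n / 32 * (m powr \<sigma> / (4*pi)) = \<psi> n * m powr \<sigma> / (128 * pi)" by simp
    ultimately show ?thesis by metis
  qed
  then have "ereal (\<psi> n * m powr \<sigma> / (128 * pi)) \<le> ereal (I / ((2*pi) powr \<sigma> * real R powr (1 - \<sigma>)))" by simp
  also have "\<dots> \<le> (INF T\<in>trig_polys n. Lnorm s (\<lambda>x. f x - T x))"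
    unfolding \<sigma>_def by (intro INF_greatest bound)
  also have "\<dots> \<le> best_approx n (Lclass \<psi> \<beta> 1) s"
    unfolding best_approx_def by (rule SUP_upper[OF f_class])
  finally show ?thesis by (simp add: m_def \<sigma>_def)
qed

section \<open>Norms of convolutions\<close>

lemma sigma_finite_lebesgue: "sigma_finite_measure (lebesgue :: real measure)"
proof
  obtain A :: "real set set" where A: "countable A" "A \<subseteq> sets lborel" "\<Union>A = space lborel" "\<forall>a\<in>A. emeasure lborel a \<noteq> \<infinity>"
    using lborel.sigma_finite_countable by blast
  have "A \<subseteq> sets lebesgue" "\<forall>a\<in>A. emeasure lebesgue a \<noteq> \<infinity>" using A(2,4) by auto
  with A show "\<exists>A::real set set. countable A \<and> A \<subseteq> sets lebesgue \<and> \<Union>A = space lebesgue \<and> (\<forall>a\<in>A. emeasure lebesgue a \<noteq> \<infinity>)"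
    by (intro exI[of _ A]) simp
qed

lemma continuous_reflect_mult_integrable:
  fixes K \<phi> :: "real \<Rightarrow> real"
  assumes K: "continuous_on UNIV K" and \<phi>: "set_integrable lebesgue {a..b} \<phi>"
  shows "set_integrable lebesgue {a..b} (\<lambda>t. K (x - t) * \<phi> t)"
proof -
  have "continuous_on {a..b} (\<lambda>t. K (x - t))"
    by (rule continuous_on_compose2[OF K]) (auto intro!: continuous_intros)
  from set_integrable_mult_continuous[OF \<phi> this] show ?thesis by (simp add: mult.commute)
qed

text \<open>\<phi> is only Lebesgue measurable, so Tonelli's theorem is prepared on the product of
  the completed measures, on which both projections are Borel measurable.\<close>

lemma convolution_measurable:
  fixes K \<phi> :: "real \<Rightarrow> real"
  assumes K: "continuous_on UNIV K" and \<phi>: "\<phi> \<in> borel_measurable lebesgue"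
  shows "(\<lambda>(x, t). K (x - t) * \<phi> t) \<in> borel_measurable (lebesgue \<Otimes>\<^sub>M lebesgue)"
proof -
  have fst: "fst \<in> borel_measurable (lebesgue \<Otimes>\<^sub>M (lebesgue :: real measure))"
    by (rule measurable_compose[OF measurable_fst]) (rule measurable_completion, simp)
  have snd: "snd \<in> borel_measurable ((lebesgue :: real measure) \<Otimes>\<^sub>M (lebesgue :: real measure))"
    by (rule measurable_compose[OF measurable_snd]) (rule measurable_completion, simp)
  have "(\<lambda>z. K (fst z - snd z)) \<in> borel_measurable ((lebesgue :: real measure) \<Otimes>\<^sub>M (lebesgue :: real measure))"
    by (rule measurable_compose[OF borel_measurable_diff[OF fst snd] borel_measurable_continuous_onI[OF K]])
  moreover have "(\<lambda>z. \<phi> (snd z)) \<in> borel_measurable ((lebesgue :: real measure) \<Otimes>\<^sub>M (lebesgue :: real measure))"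
    by (rule measurable_compose[OF measurable_snd \<phi>])
  ultimately show ?thesis by (simp add: case_prod_beta borel_measurable_times)
qed

text \<open>Young's convolution inequality on the circle. Integrals of nonnegative functions allow
  the order of integration to be exchanged with no prior integrability of the product.\<close>

lemma convolution_L1:
  fixes K \<phi> :: "real \<Rightarrow> real"
  assumes K: "continuous_on UNIV K" "periodic2pi K" and K1: "integral {-pi..pi} (\<lambda>u. \<bar>K u\<bar>) \<le> \<kappa>"
    and \<phi>: "\<phi> \<in> borel_measurable lebesgue" "set_integrable lebesgue {-pi..pi} \<phi>"
    and \<phi>1: "(LINT t:{-pi..pi}|lebesgue. \<bar>\<phi> t\<bar>) \<le> 1"
  defines "G \<equiv> \<lambda>x. LINT t:{-pi..pi}|lebesgue. K (x - t) * \<phi> t"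
  shows "G \<in> borel_measurable lebesgue"
    and "(\<integral>\<^sup>+x. indicator {0..2*pi} x * ennreal \<bar>G x\<bar> \<partial>lebesgue) \<le> ennreal \<kappa>"
proof -
  interpret sigma_finite_measure "lebesgue :: real measure" by (rule sigma_finite_lebesgue)
  interpret pair_sigma_finite "lebesgue :: real measure" "lebesgue :: real measure" ..
  note meas = convolution_measurable[OF K(1) \<phi>(1)]
  have ind1: "(\<lambda>z. indicator {a..b} (fst z) :: real) \<in> borel_measurable ((lebesgue :: real measure) \<Otimes>\<^sub>M (lebesgue :: real measure))" for a b :: real
    by (rule measurable_compose[OF measurable_fst borel_measurable_indicator]) simp
  have ind2: "(\<lambda>z. indicator {a..b} (snd z) :: real) \<in> borel_measurable ((lebesgue :: real measure) \<Otimes>\<^sub>M (lebesgue :: real measure))" for a b :: real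
    by (rule measurable_compose[OF measurable_snd borel_measurable_indicator]) simp
  have "(\<lambda>(x, t). indicator {-pi..pi} t *\<^sub>R (K (x - t) * \<phi> t)) \<in> borel_measurable (lebesgue \<Otimes>\<^sub>M lebesgue)"
    using borel_measurable_scaleR[OF ind2[of "-pi" pi] meas] by (simp add: case_prod_beta)
  then show "G \<in> borel_measurable lebesgue"
    unfolding G_def set_lebesgue_integral_def by (rule sigma_finite_measure.borel_measurable_lebesgue_integral[OF sigma_finite_lebesgue])
  have K0: "integral {-pi..pi} (\<lambda>u. \<bar>K u\<bar>) \<ge> 0"
    by (intro integral_nonneg integrable_continuous_real continuous_intros continuous_on_subset[OF K(1)]) auto
  have le: "ennreal \<bar>G x\<bar> \<le> (\<integral>\<^sup>+t. ennreal (indicator {-pi..pi} t * \<bar>K (x - t) * \<phi> t\<bar>) \<partial>lebesgue)" for x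
  proof -
    have i: "integrable lebesgue (\<lambda>t. indicator {-pi..pi} t *\<^sub>R (K (x - t) * \<phi> t))"
      using continuous_reflect_mult_integrable[OF K(1) \<phi>(2)] by (simp add: set_integrable_def)
    have "ennreal (norm (G x)) \<le> (\<integral>\<^sup>+t. ennreal (norm (indicator {-pi..pi} t *\<^sub>R (K (x - t) * \<phi> t))) \<partial>lebesgue)"
      unfolding G_def set_lebesgue_integral_def by (rule integral_norm_bound_ennreal[OF i])
    then show ?thesis by (simp add: abs_mult)
  qed
  define H where "H x t = (indicator {0..2*pi} x * (indicator {-pi..pi} t * \<bar>K (x - t) * \<phi> t\<bar>) :: real)" for x t
  have H_meas: "(\<lambda>(x, t). ennreal (H x t)) \<in> borel_measurable (lebesgue \<Otimes>\<^sub>M lebesgue)"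
  proof -
    have "(\<lambda>z. indicator {0..2*pi} (fst z) * (indicator {-pi..pi} (snd z) * \<bar>case z of (x, t) \<Rightarrow> K (x - t) * \<phi> t\<bar>) :: real)
        \<in> borel_measurable (lebesgue \<Otimes>\<^sub>M lebesgue)"
      by (intro borel_measurable_times ind1 ind2 borel_measurable_abs meas)
    then show ?thesis by (simp add: H_def case_prod_beta)
  qed
  have "(\<integral>\<^sup>+x. indicator {0..2*pi} x * ennreal \<bar>G x\<bar> \<partial>lebesgue) \<le> (\<integral>\<^sup>+x. \<integral>\<^sup>+t. ennreal (H x t) \<partial>lebesgue \<partial>lebesgue)"
  proof (rule nn_integral_mono)
    fix x
    show "indicator {0..2*pi} x * ennreal \<bar>G x\<bar> \<le> (\<integral>\<^sup>+t. ennreal (H x t) \<partial>lebesgue)"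
      using le[of x] by (cases "x \<in> {0..2*pi}") (simp_all add: H_def)
  qed
  also have "\<dots> = (\<integral>\<^sup>+t. \<integral>\<^sup>+x. ennreal (H x t) \<partial>lebesgue \<partial>lebesgue)"
    by (rule Fubini'[OF H_meas, symmetric])
  also have "\<dots> = (\<integral>\<^sup>+t. ennreal (indicator {-pi..pi} t * \<bar>\<phi> t\<bar>) * ennreal (integral {-pi..pi} (\<lambda>u. \<bar>K u\<bar>)) \<partial>lebesgue)"
  proof (rule nn_integral_cong)
    fix t
    have Kc: "continuous_on S (\<lambda>x. \<bar>K (x - t)\<bar>)" for S
      by (intro continuous_on_rabs continuous_on_compose2[OF K(1)]) (auto intro!: continuous_intros)
    have Ki: "set_integrable lebesgue {0..2*pi} (\<lambda>x. \<bar>K (x - t)\<bar>)"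
      by (rule absolutely_integrable_continuous_real[OF Kc])
    \<comment> \<open>By periodicity the inner integral does not depend on \<open>t\<close>.\<close>
    have "(LINT x:{0..2*pi}|lebesgue. \<bar>K (x - t)\<bar>) = integral {-pi..pi} (\<lambda>u. \<bar>K u\<bar>)"
    proof -
      have per: "periodic2pi (\<lambda>u. \<bar>K u\<bar>)" "periodic2pi (\<lambda>x. \<bar>K (x - t)\<bar>)"
        using K(2) unfolding periodic2pi_def by (auto simp: diff_add_eq[symmetric])
      have "((\<lambda>x. \<bar>K (x - t)\<bar>) has_integral (LINT x:{0..2*pi}|lebesgue. \<bar>K (x - t)\<bar>)) {0..2*pi}"
        by (rule has_integral_set_lebesgue[OF Ki])
      from periodic_has_integral_shift[OF per(2) this, of t]
      have "((\<lambda>x. \<bar>K (x - t)\<bar>) has_integral (LINT x:{0..2*pi}|lebesgue. \<bar>K (x - t)\<bar>)) {t..t + 2*pi}" .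
      then have "((\<lambda>u. \<bar>K u\<bar>) has_integral (LINT x:{0..2*pi}|lebesgue. \<bar>K (x - t)\<bar>)) {0..2*pi}"
        using has_integral_shift_Icc_real[of "\<lambda>x. \<bar>K (x - t)\<bar>" t _ 0 "2*pi"] by (simp add: o_def add.commute)
      from periodic_has_integral_shift[OF per(1) this, of "-pi"] show ?thesis by (simp add: integral_unique)
    qed
    moreover have "(\<integral>\<^sup>+x. ennreal (indicator {0..2*pi} x *\<^sub>R \<bar>K (x - t)\<bar>) \<partial>lebesgue) =
        ennreal (LINT x:{0..2*pi}|lebesgue. \<bar>K (x - t)\<bar>)"
      using Ki unfolding set_integrable_def set_lebesgue_integral_def by (intro nn_integral_eq_integral) auto
    ultimately have e: "(\<integral>\<^sup>+x. ennreal (indicator {0..2*pi} x *\<^sub>R \<bar>K (x - t)\<bar>) \<partial>lebesgue) =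
        ennreal (integral {-pi..pi} (\<lambda>u. \<bar>K u\<bar>))" by simp
    have "H x t = indicator {-pi..pi} t * \<bar>\<phi> t\<bar> * (indicator {0..2*pi} x *\<^sub>R \<bar>K (x - t)\<bar>)" for x
      by (simp add: H_def abs_mult mult_ac)
    then have "(\<integral>\<^sup>+x. ennreal (H x t) \<partial>lebesgue) =
        (\<integral>\<^sup>+x. ennreal (indicator {-pi..pi} t * \<bar>\<phi> t\<bar>) * ennreal (indicator {0..2*pi} x *\<^sub>R \<bar>K (x - t)\<bar>) \<partial>lebesgue)"
      by (simp add: ennreal_mult)
    also have "\<dots> = ennreal (indicator {-pi..pi} t * \<bar>\<phi> t\<bar>) * (\<integral>\<^sup>+x. ennreal (indicator {0..2*pi} x *\<^sub>R \<bar>K (x - t)\<bar>) \<partial>lebesgue)"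
      using Ki by (intro nn_integral_cmult) (auto simp: set_integrable_def)
    finally show "(\<integral>\<^sup>+x. ennreal (H x t) \<partial>lebesgue) =
        ennreal (indicator {-pi..pi} t * \<bar>\<phi> t\<bar>) * ennreal (integral {-pi..pi} (\<lambda>u. \<bar>K u\<bar>))"
      unfolding e .
  qed
  also have "\<dots> = (\<integral>\<^sup>+t. ennreal (indicator {-pi..pi} t *\<^sub>R \<bar>\<phi> t\<bar>) \<partial>lebesgue) * ennreal (integral {-pi..pi} (\<lambda>u. \<bar>K u\<bar>))"
    using set_integrable_abs[OF \<phi>(2)]
    by (subst nn_integral_multc) (auto simp: set_integrable_def)
  also have "(\<integral>\<^sup>+t. ennreal (indicator {-pi..pi} t *\<^sub>R \<bar>\<phi> t\<bar>) \<partial>lebesgue) = ennreal (LINT t:{-pi..pi}|lebesgue. \<bar>\<phi> t\<bar>)"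
    using set_integrable_abs[OF \<phi>(2)] unfolding set_integrable_def set_lebesgue_integral_def
    by (intro nn_integral_eq_integral) auto
  also have "\<dots> * ennreal (integral {-pi..pi} (\<lambda>u. \<bar>K u\<bar>)) \<le> 1 * ennreal \<kappa>"
    using \<phi>1 K1 by (intro mult_mono) (auto simp: ennreal_leI simp flip: ennreal_1)
  finally show "(\<integral>\<^sup>+x. indicator {0..2*pi} x * ennreal \<bar>G x\<bar> \<partial>lebesgue) \<le> ennreal \<kappa>" by simp
qed

text \<open>Interpolation through \<open>\<bar>h\<bar> powr r \<le> (C * m) powr (r - 1) * \<bar>h\<bar>\<close>.\<close>

lemma Lnorm_upper_bound:
  assumes h: "h \<in> borel_measurable lebesgue" and s: "1 \<le> s" and C: "C > 0" "m > 0"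
    and sup: "AE x in lebesgue. \<bar>h x\<bar> \<le> C * m"
    and L1: "(\<integral>\<^sup>+x. indicator {0..2*pi} x * ennreal \<bar>h x\<bar> \<partial>lebesgue) \<le> ennreal C"
  shows "Lnorm s h \<le> ereal (C * m powr conj_inv s)"
proof (cases "s = \<infinity>")
  case True
  have "esssup (restrict_space lebesgue {0..2*pi}) (\<lambda>x. ereal \<bar>h x\<bar>) \<le> ereal (C * m)"
  proof (rule esssup_I)
    show "(\<lambda>x. ereal \<bar>h x\<bar>) \<in> borel_measurable (restrict_space lebesgue {0..2*pi})"
      using h by (intro measurable_restrict_space1) simp
    show "AE x in restrict_space lebesgue {0..2*pi}. ereal \<bar>h x\<bar> \<le> ereal (C * m)"
      using sup by (subst AE_restrict_space_iff) (auto elim: eventually_mono)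
  qed
  then show ?thesis using True C by (simp add: Lnorm_def conj_inv_def)
next
  case False
  define r where "r = real_of_ereal s"
  have s_r: "s = ereal r" using False s by (cases s) (auto simp: r_def)
  have r: "r \<ge> 1" using s by (simp add: s_r)
  have \<sigma>: "conj_inv s = 1 - 1 / r" by (simp add: s_r conj_inv_def)
  have hr: "(\<lambda>x. \<bar>h x\<bar> powr r) \<in> borel_measurable lebesgue" using h by simp
  have pw: "\<bar>h x\<bar> powr r \<le> (C * m) powr (r - 1) * \<bar>h x\<bar>" if "\<bar>h x\<bar> \<le> C * m" for x
  proof -
    have "\<bar>h x\<bar> powr r = \<bar>h x\<bar> powr (r - 1) * \<bar>h x\<bar>"
      by (cases "h x = 0") (auto simp: powr_diff)
    also have "\<dots> \<le> (C * m) powr (r - 1) * \<bar>h x\<bar>"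
      using that r by (intro mult_right_mono powr_mono2) auto
    finally show ?thesis .
  qed
  define V where "V = (C * m) powr (r - 1) * C"
  have V0: "V \<ge> 0" using C by (simp add: V_def)
  have hm: "(\<lambda>x. indicator {0..2*pi} x * ennreal \<bar>h x\<bar>) \<in> borel_measurable lebesgue"
    using h by (auto intro!: borel_measurable_times_ennreal borel_measurable_indicator)
  have "(\<integral>\<^sup>+x. ennreal (indicator {0..2*pi} x *\<^sub>R (\<bar>h x\<bar> powr r)) \<partial>lebesgue) \<le>
      (\<integral>\<^sup>+x. ennreal ((C * m) powr (r - 1)) * (indicator {0..2*pi} x * ennreal \<bar>h x\<bar>) \<partial>lebesgue)"
  proof (rule nn_integral_mono_AE)
    show "AE x in lebesgue. ennreal (indicator {0..2*pi} x *\<^sub>R (\<bar>h x\<bar> powr r)) \<le>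
        ennreal ((C * m) powr (r - 1)) * (indicator {0..2*pi} x * ennreal \<bar>h x\<bar>)"
      using sup
    proof eventually_elim
      case (elim x)
      from pw[OF elim] have "ennreal (\<bar>h x\<bar> powr r) \<le> ennreal ((C * m) powr (r - 1)) * ennreal \<bar>h x\<bar>"
        by (simp add: ennreal_mult[symmetric] ennreal_leI)
      then show ?case by (cases "x \<in> {0..2*pi}") simp_all
    qed
  qed
  also have "\<dots> = ennreal ((C * m) powr (r - 1)) * (\<integral>\<^sup>+x. indicator {0..2*pi} x * ennreal \<bar>h x\<bar> \<partial>lebesgue)"
    by (rule nn_integral_cmult[OF hm])
  also have "\<dots> \<le> ennreal ((C * m) powr (r - 1)) * ennreal C" using L1 by (intro mult_left_mono) auto
  also have "\<dots> = ennreal V" using C by (simp add: V_def ennreal_mult)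
  finally have nn: "(\<integral>\<^sup>+x. ennreal (indicator {0..2*pi} x *\<^sub>R (\<bar>h x\<bar> powr r)) \<partial>lebesgue) \<le> ennreal V" .
  have im: "(\<lambda>x. indicator {0..2*pi} x *\<^sub>R (\<bar>h x\<bar> powr r)) \<in> borel_measurable lebesgue"
    using hr by (intro borel_measurable_scaleR borel_measurable_indicator) auto
  have si: "set_integrable lebesgue {0..2*pi} (\<lambda>x. \<bar>h x\<bar> powr r)"
    unfolding set_integrable_def
  proof (rule integrableI_bounded[OF im])
    have "(\<integral>\<^sup>+x. ennreal (norm (indicator {0..2*pi} x *\<^sub>R (\<bar>h x\<bar> powr r))) \<partial>lebesgue) \<le> ennreal V"
      using nn by simp
    also have "\<dots> < \<infinity>" by simp
    finally show "(\<integral>\<^sup>+x. ennreal (norm (indicator {0..2*pi} x *\<^sub>R (\<bar>h x\<bar> powr r))) \<partial>lebesgue) < \<infinity>" .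
  qed
  define J where "J = (LINT x:{0..2*pi}|lebesgue. \<bar>h x\<bar> powr r)"
  have J0: "J \<ge> 0" unfolding J_def set_lebesgue_integral_def by (intro integral_nonneg_AE) auto
  have "ennreal J \<le> ennreal V"
    using nn si unfolding J_def set_integrable_def set_lebesgue_integral_def
    by (subst (asm) nn_integral_eq_integral) auto
  then have JV: "J \<le> V" using V0 by (simp add: ennreal_le_iff)
  have "Lnorm s h = ereal (J powr (1/r))"
    using h si by (simp add: Lnorm_def s_r J_def)
  moreover have "J powr (1/r) \<le> V powr (1/r)" using J0 JV r by (intro powr_mono2) auto
  moreover have "V powr (1/r) = C * m powr (1 - 1/r)"
  proof -
    have "V = C powr r * m powr (r - 1)" using C by (simp add: V_def powr_mult powr_diff)
    then have "V powr (1/r) = C powr (r * (1/r)) * m powr ((r - 1) * (1/r))"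
      using C by (simp add: powr_mult powr_powr)
    also have "(r - 1) * (1/r) = 1 - 1/r" using r by (simp add: field_simps)
    finally show ?thesis using C r by simp
  qed
  ultimately show ?thesis by (simp add: \<sigma>)
qed

section \<open>Pointwise decay from second differences of the coefficients\<close>

lemma cos_series_second_difference:
  assumes c: "summable (\<lambda>k. \<bar>c k\<bar>)" and c01: "c 0 = 0" "c 1 = 0"
  shows "(\<lambda>j. (c (j+2) + c j - 2 * c (j+1)) * cos (real (j+1) * y - \<gamma>)) sums (- (2 * (1 - cos y) * cos_series c \<gamma> y))"
proof -
  \<comment> \<open>Summation by parts in disguise: shifting the index by \<open>d\<close> amounts
    to shifting the phase by \<open>d * y\<close>, and the phases \<open>y\<close> and
    \<open>-y\<close> together multiply the series by \<open>2 * cos y\<close>. The vanishing of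
    \<open>c 0\<close> and \<open>c 1\<close> removes the boundary terms.\<close>
  let ?S = "\<lambda>d. cos_series c (\<gamma> - d * y) y"
  have 1: "(\<lambda>k. c k * cos (real k * y - (\<gamma> - d * y))) sums ?S d" for d
    by (rule cos_series_sums[OF c])
  have p: "(\<lambda>j. c j * cos (real (j+1) * y - \<gamma>)) sums ?S 1"
    using 1[of 1] by (simp add: algebra_simps)
  have q: "(\<lambda>j. c (j+2) * cos (real (j+1) * y - \<gamma>)) sums ?S (-1)"
    using sums_split_initial_segment[OF 1[of "-1"], of 2] c01 by (simp add: numeral_2_eq_2 algebra_simps)
  have z: "(\<lambda>j. c (j+1) * cos (real (j+1) * y - \<gamma>)) sums ?S 0"
    using sums_split_initial_segment[OF 1[of 0], of 1] c01 by (simp add: algebra_simps)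
  have "(\<lambda>j. c (j+2) * cos (real (j+1) * y - \<gamma>) + c j * cos (real (j+1) * y - \<gamma>) - 2 * (c (j+1) * cos (real (j+1) * y - \<gamma>)))
     sums (?S (-1) + ?S 1 - 2 * ?S 0)"
    by (intro sums_add sums_diff sums_mult p q z)
  moreover have "?S (-1) + ?S 1 = 2 * cos y * ?S 0"
  proof (rule sums_unique2)
    show "(\<lambda>k. c k * cos (real k * y - (\<gamma> - (-1) * y)) + c k * cos (real k * y - (\<gamma> - 1 * y))) sums (?S (-1) + ?S 1)"
      by (intro sums_add 1)
    have "c k * cos (real k * y - (\<gamma> - (-1) * y)) + c k * cos (real k * y - (\<gamma> - 1 * y)) =
        2 * cos y * (c k * cos (real k * y - (\<gamma> - 0 * y)))" for k
    proof -
      have "real k * y - (\<gamma> - (-1) * y) = (real k * y - \<gamma>) - y" "real k * y - (\<gamma> - 1 * y) = (real k * y - \<gamma>) + y" by simp_all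
      then show ?thesis by (simp only: cos_add cos_diff[of "real k * y - \<gamma>" y]) (simp add: algebra_simps)
    qed
    then show "(\<lambda>k. c k * cos (real k * y - (\<gamma> - (-1) * y)) + c k * cos (real k * y - (\<gamma> - 1 * y))) sums (2 * cos y * ?S 0)"
      by (simp only:) (intro sums_mult 1)
  qed
  ultimately show ?thesis by (simp add: algebra_simps)
qed

lemma cos_series_abs_le:
  assumes c: "summable c" and c0: "\<And>k. c k \<ge> 0"
  shows "\<bar>cos_series c \<gamma> y\<bar> \<le> (\<Sum>k. c k)"
proof -
  have "summable (\<lambda>k. \<bar>c k\<bar>)" using c c0 by simp
  note S = cos_series_sums[OF this, of y \<gamma>]
  have "norm (\<Sum>k. c k * cos (real k * y - \<gamma>)) \<le> (\<Sum>k. c k)"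
    by (rule norm_suminf_le[OF _ c]) (use c0 in \<open>auto simp: abs_mult intro!: mult_left_le\<close>)
  then show ?thesis using S by (simp add: sums_iff)
qed

text \<open>Jordan's inequality \<open>2 * x / pi \<le> sin x\<close>, a consequence of concavity,
  at \<open>x = \<bar>u\<bar> / 2\<close>, since
  \<open>2 * (1 - cos u) = 4 * (sin x)^2\<close>.\<close>

lemma one_minus_cos_lower_bound:
  fixes u :: real
  assumes "\<bar>u\<bar> \<le> pi"
  shows "4 * u^2 / pi^2 \<le> 2 * (1 - cos u)"
proof -
  have conc: "concave_on {0..pi} sin"
    by (intro f''_le0_imp_concave[where f' = cos and f'' = "\<lambda>x. - sin x"])
       (auto intro!: derivative_eq_intros sin_ge_zero)
  define x where "x = \<bar>u\<bar> / 2"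
  have x: "0 \<le> x" "x \<le> pi/2" using assms by (auto simp: x_def)
  have "sin ((1 - 2*x/pi) *\<^sub>R 0 + (2*x/pi) *\<^sub>R (pi/2)) \<ge> (1 - 2*x/pi) * sin 0 + (2*x/pi) * sin (pi/2)"
    using x by (intro concave_onD[OF conc]) (auto simp: field_simps)
  then have "2 * x / pi \<le> sin x" by simp
  then have "(2*x/pi)^2 \<le> (sin x)^2" using x by (intro power_mono) auto
  then have "4 * x^2/pi^2 \<le> (sin x)^2" by (simp add: power_divide power_mult_distrib)
  moreover have "2 * (1 - cos u) = 4 * (sin x)^2"
  proof -
    have "cos u = cos (2 * x)" by (simp add: x_def)
    then show ?thesis by (simp add: cos_double_sin)
  qed
  moreover have "x^2 = u^2/4" by (simp add: x_def power_divide)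
  ultimately show ?thesis by simp
qed

section \<open>The upper bound\<close>

lemma B0_1_D:
  assumes "\<phi> \<in> B0 1"
  shows "\<phi> \<in> borel_measurable lebesgue" "set_integrable lebesgue {-pi..pi} \<phi>"
    "(LINT t:{-pi..pi}|lebesgue. \<bar>\<phi> t\<bar>) \<le> 1"
proof -
  have per: "periodic2pi \<phi>" "periodic2pi (\<lambda>t. \<bar>\<phi> t\<bar>)" using assms by (auto simp: B0_def periodic2pi_def)
  have i: "set_integrable lebesgue {0..2*pi} \<phi>" using assms by (simp add: B0_def)
  show "\<phi> \<in> borel_measurable lebesgue" using assms by (simp add: B0_def)
  show "set_integrable lebesgue {-pi..pi} \<phi>" using periodic_set_integrable_shift(1)[OF per(1) i, of "-pi"] by simp
  have "Lnorm 1 \<phi> \<le> 1" using assms by (simp add: B0_def)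
  moreover have "(LINT t:{0..2*pi}|lebesgue. \<bar>\<phi> t\<bar>) \<ge> 0"
    unfolding set_lebesgue_integral_def by (intro integral_nonneg_AE) auto
  ultimately have "(LINT t:{0..2*pi}|lebesgue. \<bar>\<phi> t\<bar>) \<le> 1"
    using assms set_integrable_abs[OF i] by (simp add: Lnorm_def B0_def one_ereal_def)
  then show "(LINT t:{-pi..pi}|lebesgue. \<bar>\<phi> t\<bar>) \<le> 1"
    using periodic_set_integrable_shift(2)[OF per(2) set_integrable_abs[OF i], of "-pi"] by simp
qed

text \<open>The coefficients \<open>\<tau>\<close> agree with those of \<open>\<psi>\<close> from \<open>n\<close> on and are continued below \<open>n\<close> by a
  linear ramp of width \<open>M\<close>, which alters the kernel only by a trigonometric polynomial of degree
  below \<open>n\<close>. The ramp removes the jump at \<open>n\<close> that would make the \<open>L\<^sub>1\<close> norm of the kernel grow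
  logarithmically.\<close>

context
  fixes \<psi> :: "real \<Rightarrow> real" and n M :: nat and m a b D :: real
    and \<tau> :: "nat \<Rightarrow> real" and kern :: "real \<Rightarrow> real \<Rightarrow> real"
  assumes P: "\<psi> \<in> classM_plus_inf" and b: "b > 2" "mu \<psi> (real n) \<ge> b" and n: "n \<ge> 1"
    and a: "eta \<psi> (real n) - real n \<ge> a" "a > 2"
  defines "m \<equiv> eta \<psi> (real n) - real n" and "M \<equiv> nat \<lceil>m\<rceil>" and "D \<equiv> 2 * b / (b - 2)"
    and "\<tau> \<equiv> \<lambda>k. if k < n then \<psi> n * max 0 (1 - (real n - real k) / real M) else \<psi> k"
    and "kern \<equiv> cos_series \<tau>"
begin

lemma width_gt_2: "m > 2" using a by (simp add: m_def)

text \<open>\<open>mu \<psi> n \<ge> b > 2\<close> means \<open>2 * m < n\<close>, and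
  \<open>m > 2\<close> pays for rounding up. \<open>M + 1 \<le> n\<close> ensures that \<tau>
  vanishes at both 0 and 1, as the second difference identity requires.\<close>

lemma ramp_width: "m \<le> real M" "real M < m + 1" "M + 1 \<le> n" "M > 0"
proof -
  show 1: "m \<le> real M" "real M < m + 1" using width_gt_2 unfolding M_def by linarith+
  show "M > 0" using 1(1) width_gt_2 by linarith
  have "b \<le> real n / m" using b(2) by (simp add: mu_def m_def)
  then have "b * m \<le> real n" using width_gt_2 by (simp add: pos_le_divide_eq)
  moreover have "2 * m < b * m" using b width_gt_2 by simp
  ultimately have "2 * m < real n" by linarith
  then have "real M < real n - 1" using 1(2) width_gt_2 by linarith
  then show "M + 1 \<le> n" by linarith
qed

lemma psi_pos: "k \<ge> n \<Longrightarrow> \<psi> (real k) > 0"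
  using classM_D(1)[OF classM_plus_inf_D(1)[OF P], of "real k"] n by simp

lemma ramp_nonneg: "\<tau> k \<ge> 0"
  using psi_pos[of k] psi_pos[of n] by (auto simp: \<tau>_def)

lemma ramp_zero: "k + M \<le> n \<Longrightarrow> \<tau> k = 0"
  using ramp_width(4) by (auto simp: \<tau>_def max_def field_simps)

text \<open>The ramp supplies the 1: it has \<open>M - 1 < m\<close> possibly nonzero terms below
  \<open>n\<close>, each at most \<open>\<psi> n\<close>. The tail supplies \<open>3/2 * D\<close>,
  because its bound contains \<open>m + 1 \<le> 3/2 * m\<close>.\<close>

lemma ramp_sums: "summable \<tau>" "(\<Sum>k. \<tau> k) \<le> \<psi> n * m * (1 + 3/2 * D)"
proof -
  have bd: "(\<Sum>j<N. \<tau> (j + n)) \<le> D * \<psi> n * (m + 1)" for N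
    using psi_partial_sum_bound[OF P _ b, of N] n by (simp add: \<tau>_def m_def D_def add.commute)
  have s: "summable (\<lambda>j. \<tau> (j + n))"
    using bd[of "Suc _"] by (intro bounded_imp_summable[OF ramp_nonneg]) (simp only: lessThan_Suc_atMost)
  then show "summable \<tau>" by (simp only: summable_iff_shift)
  have D0: "D > 0" using b by (simp add: D_def)
  have "(\<Sum>j. \<tau> (j + n)) \<le> D * \<psi> n * (m + 1)" by (rule suminf_le_const[OF s bd])
  also have "\<dots> \<le> D * \<psi> n * (3/2 * m)" using width_gt_2 D0 psi_pos[of n] by (intro mult_left_mono) auto
  finally have 1: "(\<Sum>j. \<tau> (j + n)) \<le> \<psi> n * m * (3/2 * D)" by (simp add: mult_ac)
  have "(\<Sum>k<n. \<tau> k) = (\<Sum>k\<in>{n - M<..<n}. \<tau> k)"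
    using ramp_width(3) by (intro sum.mono_neutral_right) (auto intro: ramp_zero)
  also have "\<dots> \<le> (\<Sum>k\<in>{n - M<..<n}. \<psi> n)"
  proof (rule sum_mono)
    fix k assume "k \<in> {n - M<..<n}"
    then show "\<tau> k \<le> \<psi> n" using psi_pos[of n] by (auto simp: \<tau>_def intro!: mult_left_le)
  qed
  also have "\<dots> = (real M - 1) * \<psi> n" using ramp_width(3,4) by (simp add: of_nat_diff)
  also have "\<dots> \<le> m * \<psi> n" using ramp_width(2) psi_pos[of n] by (intro mult_right_mono) auto
  finally have 2: "(\<Sum>k<n. \<tau> k) \<le> \<psi> n * m" by (simp add: mult.commute)
  have "(\<Sum>k. \<tau> k) = (\<Sum>j. \<tau> (j + n)) + (\<Sum>k<n. \<tau> k)"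
    by (rule suminf_split_initial_segment) fact
  with 1 2 show "(\<Sum>k. \<tau> k) \<le> \<psi> n * m * (1 + 3/2 * D)" by (simp add: distrib_left)
qed

lemma ramp_abs_summable: "summable (\<lambda>k. \<bar>\<tau> k\<bar>)"
  using ramp_sums(1) ramp_nonneg by simp

text \<open>Up to \<open>n\<close> the coefficients are the maximum of 0 and a linear function, from
  \<open>n\<close> on they follow the convex \<psi>. Both pieces share the value at
  \<open>n\<close>, so the only concave kink can be there.\<close>

lemma ramp_second_difference_nonneg:
  assumes "j + 1 \<noteq> n"
  shows "0 \<le> \<tau> (j+2) + \<tau> j - 2 * \<tau> (j+1)"
proof (cases "j + 1 < n")
  case True
  define \<rho> where "\<rho> k = 1 - (real n - real k) / real M" for k
  have eq: "\<tau> k = \<psi> n * max 0 (\<rho> k)" if "k \<le> n" for k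
    using that by (cases "k = n") (auto simp: \<tau>_def \<rho>_def)
  have "\<rho> (j+2) + \<rho> j = 2 * \<rho> (j+1)" by (simp add: \<rho>_def diff_divide_distrib add_divide_distrib)
  then have "0 \<le> max 0 (\<rho> (j+2)) + max 0 (\<rho> j) - 2 * max 0 (\<rho> (j+1))" by (auto simp: max_def)
  then have "0 \<le> \<psi> n * (max 0 (\<rho> (j+2)) + max 0 (\<rho> j) - 2 * max 0 (\<rho> (j+1)))"
    using psi_pos[of n] by simp
  then show ?thesis using True by (simp add: eq algebra_simps)
next
  case False
  then have j: "j \<ge> n" using assms by simp
  have "(\<psi> (real j + 1) - \<psi> (real j + 2)) / (real j + 2 - (real j + 1)) \<le> (\<psi> (real j) - \<psi> (real j + 1)) / (real j + 1 - real j)"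
    using j n by (intro convex_on_secant_decrease[OF classM_D(3)[OF classM_plus_inf_D(1)[OF P]]]) auto
  then show ?thesis using j by (simp add: \<tau>_def add.commute)
qed

text \<open>The second differences of \<open>\<tau>\<close> sum to zero and only the one centred at \<open>n\<close> is negative, so their
  total variation is twice its modulus.\<close>

lemma ramp_total_variation:
  "(\<lambda>j. \<bar>\<tau> (j+2) + \<tau> j - 2 * \<tau> (j+1)\<bar>) sums (2 * (\<psi> n / M + (\<psi> n - \<psi> (n + 1))))"
proof -
  define d where "d j = \<tau> (j+2) + \<tau> j - 2 * \<tau> (j+1)" for j
  define v where "v = \<psi> n / M + (\<psi> n - \<psi> (n + 1))"
  have z: "\<tau> 0 = 0" "\<tau> 1 = 0" using ramp_width(3) by (auto intro: ramp_zero)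
  note S = summable_sums[OF ramp_sums(1)]
  have "(\<lambda>j. \<tau> (j+2)) sums (\<Sum>k. \<tau> k)" "(\<lambda>j. \<tau> (j+1)) sums (\<Sum>k. \<tau> k)"
    using sums_split_initial_segment[OF S, of 2] sums_split_initial_segment[OF S, of 1] z
    by (simp_all add: numeral_2_eq_2)
  then have "d sums ((\<Sum>k. \<tau> k) + (\<Sum>k. \<tau> k) - 2 * (\<Sum>k. \<tau> k))"
    unfolding d_def by (intro sums_add sums_diff sums_mult S)
  then have d0: "d sums 0" by simp
  \<comment> \<open>The difference with index \<open>j\<close> is centred at \<open>j + 1\<close>,
    so the kink at \<open>n\<close> has index \<open>n - 1\<close>.\<close>
  have dn: "d (n - 1) = - v"
  proof -
    have "n - 1 + 2 = n + 1" "n - 1 + 1 = n" using n by auto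
    moreover have "\<tau> (n - 1) = \<psi> n * (1 - 1 / M)"
      using n ramp_width(4) by (simp add: \<tau>_def of_nat_diff)
    ultimately show ?thesis unfolding d_def v_def by (simp add: \<tau>_def algebra_simps)
  qed
  have v0: "v \<ge> 0"
    using classM_antimono[OF classM_plus_inf_D(1)[OF P], of n "n + 1"] n psi_pos[of n] by (simp add: v_def)
  have "(\<lambda>j. d j + (if j = n - 1 then 2 * v else 0)) sums (0 + 2 * v)"
    by (intro sums_add d0 sums_single)
  moreover have "d j + (if j = n - 1 then 2 * v else 0) = \<bar>d j\<bar>" for j
  proof (cases "j = n - 1")
    case False
    then have "d j \<ge> 0" unfolding d_def using n by (intro ramp_second_difference_nonneg) auto
    then show ?thesis using False by simp
  qed (use dn v0 in simp)
  ultimately show ?thesis by (simp add: d_def v_def)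
qed

text \<open>In units of \<open>\<psi> n / m\<close> the ramp has slope at most 1 and the first step
  of \<psi> at most \<open>1 + 1/2\<close>; doubling gives 5.\<close>

lemma ramp_variation_le: "2 * (\<psi> n / M + (\<psi> n - \<psi> (n + 1))) \<le> 5 * \<psi> n / m"
proof -
  have "\<psi> n / M \<le> \<psi> n / m" using ramp_width width_gt_2 psi_pos[of n] by (intro divide_left_mono) auto
  moreover have "\<psi> n - \<psi> (n + 1) \<le> \<psi> n / m * (3/2)"
  proof -
    have "1 / mu \<psi> n \<le> 1 / 2" using b by (intro divide_left_mono) auto
    then have "\<psi> n / m * (1 + 1 / mu \<psi> n) \<le> \<psi> n / m * (3/2)"
      using psi_pos[of n] width_gt_2 by (intro mult_left_mono) auto
    then show ?thesis using psi_step_upper[OF P, of n] n by (simp add: m_def add.commute)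
  qed
  ultimately show ?thesis by simp
qed

lemma kernel_sup: "\<bar>kern \<gamma> y\<bar> \<le> \<psi> n * m * (1 + 3/2 * D)"
  unfolding kern_def using cos_series_abs_le[OF ramp_sums(1) ramp_nonneg] ramp_sums(2) by (rule order_trans)

text \<open>The uniform bound governs \<open>\<bar>u\<bar>\<close> below about \<open>1 / m\<close>,
  the second differences govern the rest. Adding them produces one majorant of Cauchy type that can
  be integrated explicitly.\<close>

lemma kernel_decay:
  assumes "\<bar>u\<bar> \<le> pi"
  shows "(1 + (m * u)\<^sup>2) * \<bar>kern \<gamma> u\<bar> \<le> \<psi> n * m * (1 + 3/2 * D + 5 * pi\<^sup>2 / 4)"
proof -
  have z: "\<tau> 0 = 0" "\<tau> 1 = 0" using ramp_width(3) by (auto intro: ramp_zero)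
  note V = ramp_total_variation
  have "norm (\<Sum>j. (\<tau> (j+2) + \<tau> j - 2 * \<tau> (j+1)) * cos (real (j+1) * u - \<gamma>)) \<le> (\<Sum>j. \<bar>\<tau> (j+2) + \<tau> j - 2 * \<tau> (j+1)\<bar>)"
    by (rule norm_suminf_le[OF _ sums_summable[OF V]]) (auto simp: abs_mult intro!: mult_left_le)
  then have "\<bar>2 * (1 - cos u) * kern \<gamma> u\<bar> \<le> 2 * (\<psi> n / M + (\<psi> n - \<psi> (n + 1)))"
    using cos_series_second_difference[OF ramp_abs_summable z, of u \<gamma>] V by (simp add: sums_iff kern_def)
  also have "\<dots> \<le> 5 * \<psi> n / m" by (rule ramp_variation_le)
  finally have 1: "(2 * (1 - cos u)) * \<bar>kern \<gamma> u\<bar> \<le> 5 * \<psi> n / m" by (simp add: abs_mult)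
  have "(4 * u\<^sup>2 / pi\<^sup>2) * \<bar>kern \<gamma> u\<bar> \<le> (2 * (1 - cos u)) * \<bar>kern \<gamma> u\<bar>"
    by (intro mult_right_mono one_minus_cos_lower_bound assms) auto
  with 1 have "(4 * u\<^sup>2 / pi\<^sup>2) * \<bar>kern \<gamma> u\<bar> \<le> 5 * \<psi> n / m" by linarith
  then have "(pi\<^sup>2 * m\<^sup>2 / 4) * ((4 * u\<^sup>2 / pi\<^sup>2) * \<bar>kern \<gamma> u\<bar>) \<le> (pi\<^sup>2 * m\<^sup>2 / 4) * (5 * \<psi> n / m)"
    by (intro mult_left_mono) auto
  then have "(m * u)\<^sup>2 * \<bar>kern \<gamma> u\<bar> \<le> \<psi> n * m * (5 * pi\<^sup>2 / 4)"
    using width_gt_2 by (simp add: power2_eq_square field_simps)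
  with kernel_sup[of \<gamma> u] show ?thesis by (simp add: algebra_simps)
qed

lemma kernel_continuous: "continuous_on A (kern \<gamma>)"
  unfolding kern_def by (rule cos_series_continuous[OF ramp_abs_summable])

text \<open>The majorant \<open>m / (1 + (m * u)^2)\<close> is the derivative of
  \<open>arctan (m * u)\<close>, so its integral stays below \<open>pi\<close> for every
  \<open>m\<close> and the width drops out.\<close>

lemma kernel_L1: "integral {-pi..pi} (\<lambda>u. \<bar>kern \<gamma> u\<bar>) \<le> pi * \<psi> n * (1 + 3/2 * D + 5 * pi\<^sup>2 / 4)"
proof -
  define E where "E = 1 + 3/2 * D + 5 * pi\<^sup>2 / 4"
  have E0: "E > 0" using b by (simp add: E_def D_def add_pos_nonneg)
  have at: "((\<lambda>u. \<psi> n * E * (m / (1 + (m * u)\<^sup>2))) has_integral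
      (\<psi> n * E * (arctan (m * pi) - arctan (m * (- pi))))) {-pi..pi}"
  proof (intro has_integral_mult_right fundamental_theorem_of_calculus)
    fix u
    have "((\<lambda>u. arctan (m * u)) has_real_derivative m / (1 + (m * u)\<^sup>2)) (at u within {-pi..pi})"
      by (auto intro!: derivative_eq_intros simp: divide_inverse)
    then show "((\<lambda>u. arctan (m * u)) has_vector_derivative m / (1 + (m * u)\<^sup>2)) (at u within {-pi..pi})"
      by (simp add: has_real_derivative_iff_has_vector_derivative)
  qed simp
  have "integral {-pi..pi} (\<lambda>u. \<bar>kern \<gamma> u\<bar>) \<le> integral {-pi..pi} (\<lambda>u. \<psi> n * E * (m / (1 + (m * u)\<^sup>2)))"
  proof (rule integral_le)
    show "(\<lambda>u. \<bar>kern \<gamma> u\<bar>) integrable_on {-pi..pi}"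
      by (intro integrable_continuous_real continuous_intros kernel_continuous)
    show "(\<lambda>u. \<psi> n * E * (m / (1 + (m * u)\<^sup>2))) integrable_on {-pi..pi}" using at by blast
    fix u assume "u \<in> {-pi..pi}"
    then have "(1 + (m * u)\<^sup>2) * \<bar>kern \<gamma> u\<bar> \<le> \<psi> n * m * E"
      unfolding E_def by (intro kernel_decay) auto
    moreover have "1 + (m * u)\<^sup>2 > 0" by (simp add: add_pos_nonneg)
    ultimately show "\<bar>kern \<gamma> u\<bar> \<le> \<psi> n * E * (m / (1 + (m * u)\<^sup>2))"
      by (simp add: pos_le_divide_eq mult_ac)
  qed
  also have "\<dots> = \<psi> n * E * (2 * arctan (m * pi))" using at by (simp add: integral_unique arctan_minus)
  also have "\<dots> \<le> \<psi> n * E * pi"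
    using arctan_ubound[of "m * pi"] psi_pos[of n] E0 by (intro mult_left_mono) auto
  finally show ?thesis by (simp add: E_def mult_ac)
qed

lemma psi_minus_ramp:
  "cos_series (psi_coeff \<psi>) \<gamma> y = kern \<gamma> y + (\<Sum>k<n. (psi_coeff \<psi> k - \<tau> k) * cos (real k * y - \<gamma>))"
proof -
  have "(\<lambda>k. psi_coeff \<psi> k * cos (real k * y - \<gamma>) - \<tau> k * cos (real k * y - \<gamma>)) sums (cos_series (psi_coeff \<psi>) \<gamma> y - kern \<gamma> y)"
    unfolding kern_def by (intro sums_diff cos_series_sums psi_coeff_summable[OF P b n] ramp_abs_summable)
  then have "(\<lambda>k. (psi_coeff \<psi> k - \<tau> k) * cos (real k * y - \<gamma>)) sums (cos_series (psi_coeff \<psi>) \<gamma> y - kern \<gamma> y)"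
    by (simp add: left_diff_distrib)
  moreover have "(\<lambda>k. (psi_coeff \<psi> k - \<tau> k) * cos (real k * y - \<gamma>)) sums (\<Sum>k<n. (psi_coeff \<psi> k - \<tau> k) * cos (real k * y - \<gamma>))"
    using n by (intro sums_finite) (auto simp: psi_coeff_def \<tau>_def)
  ultimately have "cos_series (psi_coeff \<psi>) \<gamma> y - kern \<gamma> y = (\<Sum>k<n. (psi_coeff \<psi> k - \<tau> k) * cos (real k * y - \<gamma>))"
    by (rule sums_unique2)
  then show ?thesis by simp
qed

text \<open>The series of \<psi> and the kernel differ by finitely many terms of frequency below
  \<open>n\<close>, and convolving these with \<phi> gives a polynomial with coefficients
  \<open>Ic\<close> and \<open>Is\<close>. The constant \<open>a0 / 2\<close> joins the term
  \<open>k = 0\<close>, which is present since \<open>n \<ge> 1\<close>.\<close>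

lemma Lclass_kernel_representation:
  assumes f: "f \<in> Lclass \<psi> \<beta> 1"
  obtains \<phi> T where "\<phi> \<in> B0 1" "T \<in> trig_polys n"
    "AE x in lebesgue. f x - T x = (1/pi) * (LINT t:{-pi..pi}|lebesgue. kern (\<beta>*pi/2) (x - t) * \<phi> t)"
proof -
  define \<gamma> where "\<gamma> = \<beta> * pi / 2"
  define S where "S = cos_series (psi_coeff \<psi>) \<gamma>"
  note c_sum = psi_coeff_summable[OF P b n]
  obtain \<Psi> a0 \<phi> where \<Psi>: "is_Psi_beta \<psi> \<beta> \<Psi>" and \<phi>: "\<phi> \<in> B0 1"
    and f_eq: "AE x in lebesgue. f x = a0 / 2 + (1/pi) * (LINT t:{-pi..pi}|lebesgue. \<Psi> (x - t) * \<phi> t)"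
    using f by (auto simp: Lclass_def)
  note \<phi>' = B0_1_D[OF \<phi>]
  have S_cont: "continuous_on A S" for A unfolding S_def by (rule cos_series_continuous[OF c_sum])
  have AE_eq: "AE t in lebesgue. S t = \<Psi> t"
    using is_Psi_beta_unique[OF is_Psi_beta_cos_series[OF c_sum] \<Psi>] by (simp add: S_def \<gamma>_def)
  have \<Psi>S: "(LINT t:{-pi..pi}|lebesgue. \<Psi> (x - t) * \<phi> t) = (LINT t:{-pi..pi}|lebesgue. S (x - t) * \<phi> t)" for x
  proof -
    have ae: "AE t in lebesgue. indicator {-pi..pi} t *\<^sub>R (S (x - t) * \<phi> t) = indicator {-pi..pi} t *\<^sub>R (\<Psi> (x - t) * \<phi> t)"
      using AE_lebesgue_reflect[OF AE_eq, of x] by eventually_elim simp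
    have m: "(\<lambda>t. indicator {-pi..pi} t *\<^sub>R (S (x - t) * \<phi> t)) \<in> borel_measurable lebesgue"
      using continuous_reflect_mult_integrable[OF S_cont \<phi>'(2)] by (simp add: set_integrable_def)
    have ae': "AE t in lebesgue. indicator {-pi..pi} t *\<^sub>R (\<Psi> (x - t) * \<phi> t) = indicator {-pi..pi} t *\<^sub>R (S (x - t) * \<phi> t)"
      using ae by (rule eventually_mono) (rule sym)
    show ?thesis unfolding set_lebesgue_integral_def
      by (rule integral_cong_AE[OF borel_measurable_AE[OF m ae] m ae'])
  qed
  define e where "e k = psi_coeff \<psi> k - \<tau> k" for k
  define Ic where "Ic k = (LINT t:{-pi..pi}|lebesgue. cos (real k * t + \<gamma>) * \<phi> t)" for k
  define Is where "Is k = (LINT t:{-pi..pi}|lebesgue. sin (real k * t + \<gamma>) * \<phi> t)" for k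
  have cs_int: "set_integrable lebesgue {-pi..pi} (\<lambda>t. cos (real k * t + \<gamma>) * \<phi> t)"
      "set_integrable lebesgue {-pi..pi} (\<lambda>t. sin (real k * t + \<gamma>) * \<phi> t)" for k
    by (subst mult.commute, intro set_integrable_mult_continuous[OF \<phi>'(2)] continuous_intros)+
  define T where "T x = (\<Sum>k<n. (e k / pi * Ic k + (if k = 0 then a0 / 2 else 0)) * cos (real k * x)
      + (e k / pi * Is k) * sin (real k * x))" for x
  have T_poly: "T \<in> trig_polys n" unfolding trig_polys_def T_def[abs_def]
    by (rule CollectI, rule exI[of _ "\<lambda>k. e k / pi * Ic k + (if k = 0 then a0 / 2 else 0)"],
        rule exI[of _ "\<lambda>k. e k / pi * Is k"], rule refl)
  have conv: "(LINT t:{-pi..pi}|lebesgue. S (x - t) * \<phi> t) =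
      (LINT t:{-pi..pi}|lebesgue. kern \<gamma> (x - t) * \<phi> t) + (\<Sum>k<n. e k * (cos (real k * x) * Ic k + sin (real k * x) * Is k))" for x
  proof (rule has_integral_unique)
    show "((\<lambda>t. S (x - t) * \<phi> t) has_integral (LINT t:{-pi..pi}|lebesgue. S (x - t) * \<phi> t)) {-pi..pi}"
      by (intro has_integral_set_lebesgue continuous_reflect_mult_integrable S_cont \<phi>')
    have "((\<lambda>t. kern \<gamma> (x - t) * \<phi> t +
          (\<Sum>k<n. e k * (cos (real k * x) * (cos (real k * t + \<gamma>) * \<phi> t) + sin (real k * x) * (sin (real k * t + \<gamma>) * \<phi> t)))) has_integral
        (LINT t:{-pi..pi}|lebesgue. kern \<gamma> (x - t) * \<phi> t) + (\<Sum>k<n. e k * (cos (real k * x) * Ic k + sin (real k * x) * Is k))) {-pi..pi}"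
      unfolding Ic_def Is_def
      by (intro has_integral_add has_integral_sum has_integral_mult_right has_integral_set_lebesgue
          continuous_reflect_mult_integrable kernel_continuous \<phi>' cs_int) auto
    moreover have "S (x - t) * \<phi> t = kern \<gamma> (x - t) * \<phi> t +
          (\<Sum>k<n. e k * (cos (real k * x) * (cos (real k * t + \<gamma>) * \<phi> t) + sin (real k * x) * (sin (real k * t + \<gamma>) * \<phi> t)))" for t
    proof -
      have "cos (real k * (x - t) - \<gamma>) = cos (real k * x) * cos (real k * t + \<gamma>) + sin (real k * x) * sin (real k * t + \<gamma>)" for k
        using cos_diff[of "real k * x" "real k * t + \<gamma>"] by (simp add: algebra_simps)
      then show ?thesis unfolding S_def psi_minus_ramp
        by (simp add: e_def distrib_right sum_distrib_right mult.assoc)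
    qed
    ultimately show "((\<lambda>t. S (x - t) * \<phi> t) has_integral
        (LINT t:{-pi..pi}|lebesgue. kern \<gamma> (x - t) * \<phi> t) + (\<Sum>k<n. e k * (cos (real k * x) * Ic k + sin (real k * x) * Is k))) {-pi..pi}"
      by simp
  qed
  have T_eq: "T x = a0 / 2 + (1/pi) * (\<Sum>k<n. e k * (cos (real k * x) * Ic k + sin (real k * x) * Is k))" for x
  proof -
    have "T x = (\<Sum>k<n. (if k = 0 then a0 / 2 else 0)) + (\<Sum>k<n. (1/pi) * (e k * (cos (real k * x) * Ic k + sin (real k * x) * Is k)))"
      unfolding T_def sum.distrib[symmetric] by (intro sum.cong) (auto simp: algebra_simps)
    also have "(\<Sum>k<n. (if k = 0 then a0 / 2 else 0)) = a0 / 2" using n by simp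
    finally show ?thesis by (simp only: sum_distrib_left)
  qed
  have "AE x in lebesgue. f x - T x = (1/pi) * (LINT t:{-pi..pi}|lebesgue. kern \<gamma> (x - t) * \<phi> t)"
    using f_eq
  proof eventually_elim
    case (elim x)
    then show ?case unfolding \<Psi>S conv T_eq by (simp add: distrib_left)
  qed
  then show ?thesis using that[OF \<phi> T_poly] by (simp add: \<gamma>_def)
qed

text \<open>Here \<open>Q = D + a / (a - 1) \<ge> 3\<close>, so \<open>5 * pi^2 / 4\<close> is at
  most \<open>5 * pi^2 / 12 * Q\<close> and everything becomes a multiple of \<open>Q\<close>. What
  remains is an inequality in \<open>pi\<close> alone, settled by
  \<open>3 < pi < 3.2\<close>.\<close>

lemma constant_bounds:
  defines "C \<equiv> 2 * (1 + pi\<^sup>2) / pi * (D + a / (a - 1))"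
  shows "(1 + 3/2 * D) / pi \<le> C" "1 + 3/2 * D + 5 * pi\<^sup>2 / 4 \<le> C"
proof -
  define Q where "Q = D + a / (a - 1)"
  have D2: "D \<ge> 2" using b by (simp add: D_def field_simps)
  have "a / (a - 1) \<ge> 1" using a by (simp add: field_simps)
  then have Q: "Q \<ge> 3" "1 + 3/2 * D \<le> 3/2 * Q" using D2 by (auto simp: Q_def)
  have pi: "3 < pi" "pi < 3.2" using pi_gt3 pi_approx by auto
  have pi2: "pi\<^sup>2 \<ge> 9" using power_mono[of 3 pi 2] pi by simp
  have key: "(3/2 + 5 * pi\<^sup>2 / 12) * pi \<le> 2 * (1 + pi\<^sup>2)"
  proof -
    have "(3/2 + 5 * pi\<^sup>2 / 12) * pi \<le> (3/2 + 5 * pi\<^sup>2 / 12) * 3.2"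
      using pi by (intro mult_left_mono) (auto intro: add_nonneg_nonneg)
    then show ?thesis using pi2 by simp
  qed
  have "1 + 3/2 * D + 5 * pi\<^sup>2 / 4 \<le> (3/2 + 5 * pi\<^sup>2 / 12) * Q"
  proof -
    have "5 * pi\<^sup>2 / 12 * 3 \<le> 5 * pi\<^sup>2 / 12 * Q" using Q by (intro mult_left_mono) auto
    moreover have "(3/2 + 5 * pi\<^sup>2 / 12) * Q = 3/2 * Q + 5 * pi\<^sup>2 / 12 * Q" by (rule distrib_right)
    ultimately show ?thesis using Q(2) by linarith
  qed
  also have "\<dots> \<le> 2 * (1 + pi\<^sup>2) / pi * Q"
    using key Q pi by (intro mult_right_mono) (auto simp: pos_le_divide_eq)
  finally show 2: "1 + 3/2 * D + 5 * pi\<^sup>2 / 4 \<le> C" by (simp add: C_def Q_def)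
  have "(1 + 3/2 * D) / pi \<le> 1 + 3/2 * D" using pi D2 by (simp add: divide_le_eq mult_le_cancel_left1)
  also have "\<dots> \<le> 1 + 3/2 * D + 5 * pi\<^sup>2 / 4" by simp
  finally show "(1 + 3/2 * D) / pi \<le> C" using 2 by linarith
qed

lemma best_approx_upper:
  assumes s: "1 \<le> s"
  shows "best_approx n (Lclass \<psi> \<beta> 1) s \<le> ereal (2 * (1 + pi\<^sup>2) / pi * (D + a / (a - 1)) * \<psi> n * m powr conj_inv s)"
  unfolding best_approx_def
proof (rule SUP_least)
  define C where "C = 2 * (1 + pi\<^sup>2) / pi * (D + a / (a - 1)) * \<psi> n"
  have C_bounds: "(1 + 3/2 * D) / pi * \<psi> n \<le> C" "(1 + 3/2 * D + 5 * pi\<^sup>2 / 4) * \<psi> n \<le> C"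
    using constant_bounds[THEN mult_right_mono, of "\<psi> n"] psi_pos[of n] by (simp_all only: C_def less_imp_le le_refl)
  have D0: "D > 0" using b by (simp add: D_def)
  have C0: "C > 0"
  proof -
    have "0 < (1 + 3/2 * D) / pi * \<psi> n" using D0 psi_pos[of n] by simp
    then show ?thesis using C_bounds(1) by linarith
  qed
  fix f assume "f \<in> Lclass \<psi> \<beta> 1"
  from Lclass_kernel_representation[OF this] obtain \<phi> T where \<phi>: "\<phi> \<in> B0 1" and T: "T \<in> trig_polys n"
    and eq: "AE x in lebesgue. f x - T x = (1/pi) * (LINT t:{-pi..pi}|lebesgue. kern (\<beta>*pi/2) (x - t) * \<phi> t)" by blast
  define K where "K = kern (\<beta>*pi/2)"
  note \<phi>' = B0_1_D[OF \<phi>]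
  define G where "G x = (LINT t:{-pi..pi}|lebesgue. K (x - t) * \<phi> t)" for x
  have eqG: "AE x in lebesgue. (1/pi) * G x = f x - T x" using eq by (simp add: G_def K_def eq_commute)
  have K: "continuous_on UNIV K" "periodic2pi K"
    unfolding K_def by (rule kernel_continuous) (simp add: kern_def cos_series_periodic)
  have K1: "integral {-pi..pi} (\<lambda>u. \<bar>K u\<bar>) \<le> pi * C"
    unfolding K_def using kernel_L1[of "\<beta>*pi/2"]
  proof (rule order_trans)
    have "pi * ((1 + 3/2 * D + 5 * pi\<^sup>2 / 4) * \<psi> n) \<le> pi * C"
      using C_bounds(2) by (rule mult_left_mono) simp
    then show "pi * \<psi> n * (1 + 3/2 * D + 5 * pi\<^sup>2 / 4) \<le> pi * C" by (simp only: mult_ac)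
  qed
  have GL1: "G \<in> borel_measurable lebesgue" "(\<integral>\<^sup>+x. indicator {0..2*pi} x * ennreal \<bar>G x\<bar> \<partial>lebesgue) \<le> ennreal (pi * C)"
    using convolution_L1[OF K K1 \<phi>'] unfolding G_def by auto
  \<comment> \<open>Members of the class are prescribed only almost everywhere. Completeness of
    Lebesgue measure still makes the difference measurable; for finite \<open>s\<close>,
    \<open>Lnorm\<close> would otherwise be infinite.\<close>
  have hm: "(\<lambda>x. f x - T x) \<in> borel_measurable lebesgue"
    by (rule borel_measurable_AE[OF _ eqG]) (use GL1(1) in simp)
  have Gsup: "\<bar>G x\<bar> \<le> pi * (C * m)" for x
  proof -
    define B where "B = \<psi> n * m * (1 + 3/2 * D)"
    have B0: "B \<ge> 0" using psi_pos[of n] width_gt_2 D0 by (simp add: B_def)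
    note i = continuous_reflect_mult_integrable[OF K(1) \<phi>'(2), of x]
    have "\<bar>G x\<bar> \<le> (LINT t:{-pi..pi}|lebesgue. \<bar>K (x - t) * \<phi> t\<bar>)"
      using set_integral_norm_bound[OF i] by (simp add: G_def)
    also have "\<dots> \<le> (LINT t:{-pi..pi}|lebesgue. B * \<bar>\<phi> t\<bar>)"
    proof (intro set_integral_mono set_integrable_abs[OF i] set_integrable_mult_right)
      fix t
      have "\<bar>K (x - t)\<bar> \<le> B" unfolding K_def B_def by (rule kernel_sup)
      then show "\<bar>K (x - t) * \<phi> t\<bar> \<le> B * \<bar>\<phi> t\<bar>" unfolding abs_mult by (intro mult_right_mono) auto
    qed (rule set_integrable_abs[OF \<phi>'(2)])
    also have "\<dots> = B * (LINT t:{-pi..pi}|lebesgue. \<bar>\<phi> t\<bar>)" by simp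
    also have "\<dots> \<le> B * 1" using \<phi>'(3) B0 by (intro mult_left_mono) auto
    also have "\<dots> = pi * (((1 + 3/2 * D) / pi * \<psi> n) * m)" by (simp add: B_def)
    also have "\<dots> \<le> pi * (C * m)" using C_bounds(1) width_gt_2 by (intro mult_left_mono mult_right_mono) auto
    finally show ?thesis .
  qed
  have "Lnorm s (\<lambda>x. f x - T x) \<le> ereal (C * m powr conj_inv s)"
  proof (rule Lnorm_upper_bound[OF hm s C0])
    show "m > 0" using width_gt_2 by simp
    show "AE x in lebesgue. \<bar>f x - T x\<bar> \<le> C * m"
      using eqG
    proof eventually_elim
      case (elim x)
      show ?case using Gsup[of x] unfolding elim[symmetric] abs_mult by (simp add: divide_le_eq mult_ac)
    qed
    have "(\<integral>\<^sup>+x. indicator {0..2*pi} x * ennreal \<bar>f x - T x\<bar> \<partial>lebesgue) =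
        (\<integral>\<^sup>+x. ennreal (1/pi) * (indicator {0..2*pi} x * ennreal \<bar>G x\<bar>) \<partial>lebesgue)"
    proof (rule nn_integral_cong_AE)
      show "AE x in lebesgue. indicator {0..2*pi} x * ennreal \<bar>f x - T x\<bar> = ennreal (1/pi) * (indicator {0..2*pi} x * ennreal \<bar>G x\<bar>)"
        using eqG
      proof eventually_elim
        case (elim x)
        have "ennreal \<bar>f x - T x\<bar> = ennreal (1/pi) * ennreal \<bar>G x\<bar>"
          unfolding elim[symmetric] abs_mult by (simp add: ennreal_mult[symmetric])
        then show ?case by (simp add: mult_ac)
      qed
    qed
    also have "\<dots> = ennreal (1/pi) * (\<integral>\<^sup>+x. indicator {0..2*pi} x * ennreal \<bar>G x\<bar> \<partial>lebesgue)"
      using GL1(1) by (intro nn_integral_cmult) (auto intro!: borel_measurable_times_ennreal borel_measurable_indicator)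
    also have "\<dots> \<le> ennreal (1/pi) * ennreal (pi * C)" by (intro mult_left_mono GL1) auto
    also have "\<dots> = ennreal C" using C0 by (simp add: ennreal_mult[symmetric])
    finally show "(\<integral>\<^sup>+x. indicator {0..2*pi} x * ennreal \<bar>f x - T x\<bar> \<partial>lebesgue) \<le> ennreal C" .
  qed
  then show "(INF t\<in>trig_polys n. Lnorm s (\<lambda>x. f x - t x)) \<le> ereal (2 * (1 + pi\<^sup>2) / pi * (D + a / (a - 1)) * \<psi> n * m powr conj_inv s)"
    unfolding C_def by (rule INF_lower2[OF T])
qed

end

text \<open>The fraction in \<open>a\<close> stays below its limit \<open>1/3\<close> at infinity:
  after substituting \<open>a = x + 2\<close> the difference of the two sides of the polynomial
  inequality has only positive coefficients. The rest is
  \<open>128 * pi^2 \<le> 288 * (1 + pi^2)^2\<close>.\<close>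

lemma lower_constant_le:
  fixes a :: real
  assumes "a > 2"
  shows "pi / (96 * (1 + pi^2)^2) * ((a-1)^2 * (a-2)^2 / (a^3 * (3*a-4))) \<le> 1 / (128 * pi)"
proof -
  have "3 * ((a-1)^2 * (a-2)^2) \<le> a^3 * (3*a-4)"
  proof -
    define x where "x = a - 2"
    have "a = x + 2" "x > 0" using assms by (auto simp: x_def)
    then show ?thesis by (simp add: power2_eq_square power3_eq_cube algebra_simps)
  qed
  moreover have "a^3 * (3*a-4) > 0" using assms by simp
  ultimately have 1: "(a-1)^2 * (a-2)^2 / (a^3 * (3*a-4)) \<le> 1/3" by (simp add: divide_le_eq)
  have "pi^2 \<ge> 1" using power_mono[of 1 pi 2] pi_gt3 by simp
  have "128 * pi * pi \<le> 288 * (1 + pi^2)^2"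
    using \<open>pi^2 \<ge> 1\<close> by (simp add: power2_eq_square algebra_simps)
  then have 2: "pi / (96 * (1 + pi^2)^2) * (1/3) \<le> 1 / (128 * pi)"
    by (simp add: divide_simps add_pos_nonneg) 
  have "pi / (96 * (1 + pi^2)^2) * ((a-1)^2 * (a-2)^2 / (a^3 * (3*a-4))) \<le> pi / (96 * (1 + pi^2)^2) * (1/3)"
    by (intro mult_left_mono 1) auto
  with 2 show ?thesis by linarith
qed

theorem theorem2:
  fixes \<psi> :: "real \<Rightarrow> real" and \<beta> :: real and s :: ereal and n :: nat and a b :: real
  assumes "\<psi> \<in> classM_plus_inf"
    and "1 \<le> s"
    and "n \<ge> 1"
    and "eta \<psi> (real n) - real n \<ge> a" and "a > 2"
    and "mu \<psi> (real n) \<ge> b" and "b > 2"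
  shows "ereal (pi / (96 * (1 + pi^2)^2) * ((a-1)^2 * (a-2)^2 / (a^3 * (3*a-4)))
            * \<psi> (real n) * (eta \<psi> (real n) - real n) powr conj_inv s)
           \<le> best_approx n (Lclass \<psi> \<beta> 1) s
       \<and> best_approx n (Lclass \<psi> \<beta> 1) s
           \<le> ereal (2 * (1 + pi^2) / pi * (2*b/(b-2) + a/(a-1))
            * \<psi> (real n) * (eta \<psi> (real n) - real n) powr conj_inv s)"
proof
  show "best_approx n (Lclass \<psi> \<beta> 1) s
           \<le> ereal (2 * (1 + pi^2) / pi * (2*b/(b-2) + a/(a-1))
            * \<psi> (real n) * (eta \<psi> (real n) - real n) powr conj_inv s)"
    using best_approx_upper[OF assms(1,7,6,3,4,5,2)] .
  have "\<psi> (real n) > 0" using classM_D(1)[OF classM_plus_inf_D(1)[OF assms(1)]] assms(3) by simp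
  then have "pi / (96 * (1 + pi^2)^2) * ((a-1)^2 * (a-2)^2 / (a^3 * (3*a-4))) * (\<psi> n * (eta \<psi> n - n) powr conj_inv s)
      \<le> 1 / (128 * pi) * (\<psi> n * (eta \<psi> n - n) powr conj_inv s)"
    by (intro mult_right_mono lower_constant_le assms) auto
  then have "ereal (pi / (96 * (1 + pi^2)^2) * ((a-1)^2 * (a-2)^2 / (a^3 * (3*a-4)))
            * \<psi> (real n) * (eta \<psi> (real n) - real n) powr conj_inv s)
      \<le> ereal (\<psi> n * (eta \<psi> n - n) powr conj_inv s / (128 * pi))" by (simp add: mult.assoc)
  also have "\<dots> \<le> best_approx n (Lclass \<psi> \<beta> 1) s"
    using assms by (intro best_approx_lower[of \<psi> b]) auto
  finally show "ereal (pi / (96 * (1 + pi^2)^2) * ((a-1)^2 * (a-2)^2 / (a^3 * (3*a-4)))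
            * \<psi> (real n) * (eta \<psi> (real n) - real n) powr conj_inv s)
           \<le> best_approx n (Lclass \<psi> \<beta> 1) s" .
qed

end
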